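(* Let $p$ be an odd prime and $r\ge 1$. For $q\ge 2$ the maps $\sigma(b)=\frac{s+\lambda b}{1+p^rcb}$, $\pi(a)=\frac{c+\lambda a}{1+p^rsa}$ (for $(c,s,\lambda)\in R_q\times R_q\times R_q^\times$) are compatible with the reduction $R_q\to R_{q-1}$, so that reducing the triple $(c,s,\lambda)$ modulo $p^{q-1}$ gives transition homomorphisms $\mathfrak M_{p;r,q}\to\mathfrak M_{p;r,q-1}$. The inverse limit of groups over $q$ is $$\varprojlim_q \mathfrak M_{p;r,q}\;\cong\;\left\{\begin{pmatrix}\lambda& s\\ p^r c&1\end{pmatrix}: c,s\in\mathbf Z_p,\ \lambda\in\mathbf Z_p^\times\right\}\subseteq \mathrm{PGL}_2(\mathbf Z_p),$$ and this is the congruence subgroup of $\mathrm{PGL}_2(\mathbf Z_p)$ consisting of the classes of matrices in $\mathrm{GL}_2(\mathbf Z_p)$ whose lower-left entry has $p$-adic valuation at least $r$ (a $\Gamma_0(p^r)$-type subgroup).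
   Context: $\mathbf Z_p$ is the ring of $p$-adic integers, $R_q=\mathbf Z/p^q\mathbf Z$. For each $q\ge1$ fix a faithful (injective) character $\chi$ of the cyclic group $(1+p^r\mathbf Z_p)/(1+p^{q+r}\mathbf Z_p)$ and let $H_{p;r,q}$ be the matrix with rows $H_a(b)=\chi(1+p^r ab)$, $a,b\in R_q$. $\mathfrak M_{p;r,q}$ is the group of projective monomial automorphisms of $H_{p;r,q}$: quadruples $(\pi,\sigma,\alpha,\omega)$ of permutations $\pi,\sigma$ of $R_q$ and unimodular complex functions $\alpha,\omega$ on $R_q$ with $H_a(\sigma(b))\omega(b)=\alpha_aH_{\pi(a)}(b)$ for all $a,b$, modulo $(\pi,\sigma,\alpha,\omega)\sim(\pi,\sigma,\zeta\alpha,\zeta\omega)$, $|\zeta|=1$; the product of two elements has row permutation $\pi\circ\pi'$ and column permutation $\sigma'\circ\sigma$. Each element is given by a unique triple $(c,s,\lambda)\in R_q\times R_q\times R_q^\times$ through $$\sigma(b)=\frac{s+\lambda b}{1+p^rcb},\quad \pi(a)=\frac{c+\lambda a}{1+p^rsa},\quad \omega(b)=H_c(b),\quad \alpha_a=H_a(s),$$ every triple occurs, and the group law on triples is $$(c,s,\lambda)\cdot(c',s',\lambda')=\left(\frac{c+\lambda c'}{u},\frac{\lambda's+s'}{u},\frac{\lambda\lambda'+p^rcs'}{u}\right),\quad u=1+p^rsc'.$$ *)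

theory Defs
  imports
    Complex_Main
    "HOL-Library.Extended_Nat"
    "HOL-Number_Theory.Residues"
    "HOL-Algebra.Algebra"
begin

section \<open>The p-adic integers\<close>

text \<open>A p-adic integer is a coherent sequence of residues: the entry at \<open>n\<close> is its
  representative modulo \<open>p ^ n\<close> in \<open>{0..<p ^ n}\<close>.\<close>

definition Zp :: "nat \<Rightarrow> (nat \<Rightarrow> int) ring" where
  "Zp p =
    \<lparr>carrier = {x. \<forall>n. x n \<in> {0..<int p ^ n} \<and> x (Suc n) mod int p ^ n = x n},
     monoid.mult = \<lambda>x y n. (x n * y n) mod int p ^ n,
     one = \<lambda>n. 1 mod int p ^ n,
     ring.zero = \<lambda>n. 0,
     ring.add = \<lambda>x y n. (x n + y n) mod int p ^ n\<rparr>"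

definition Zp_of_int :: "nat \<Rightarrow> int \<Rightarrow> (nat \<Rightarrow> int)" where
  "Zp_of_int p k = (\<lambda>n. k mod int p ^ n)"

text \<open>The supremum is \<open>\<infinity>\<close> exactly for the zero element.\<close>

definition padic_val :: "nat \<Rightarrow> (nat \<Rightarrow> int) \<Rightarrow> enat" where
  "padic_val p x = (SUP n \<in> {n. Zp_of_int p (int p ^ n) divides\<^bsub>Zp p\<^esub> x}. enat n)"

text \<open>The multiplicative groups \<open>1 + p ^ n Zp\<close> (for \<open>n \<ge> 1\<close>) and their quotients.\<close>

definition principal_units :: "nat \<Rightarrow> nat \<Rightarrow> (nat \<Rightarrow> int) set" where
  "principal_units p n =
    {\<one>\<^bsub>Zp p\<^esub> \<oplus>\<^bsub>Zp p\<^esub> Zp_of_int p (int p ^ n) \<otimes>\<^bsub>Zp p\<^esub> y | y. y \<in> carrier (Zp p)}"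

definition principal_units_group :: "nat \<Rightarrow> nat \<Rightarrow> (nat \<Rightarrow> int) monoid" where
  "principal_units_group p n = (units_of (Zp p))\<lparr>carrier := principal_units p n\<rparr>"

definition principal_units_quotient :: "nat \<Rightarrow> nat \<Rightarrow> nat \<Rightarrow> (nat \<Rightarrow> int) set monoid" where
  "principal_units_quotient p r q = principal_units_group p r Mod principal_units p (q + r)"

section \<open>The matrix H and its projective monomial automorphisms\<close>

definition circle_group :: "complex monoid" where
  "circle_group = \<lparr>carrier = {z. cmod z = 1}, monoid.mult = (*), one = 1\<rparr>"

definition faithful_character :: "nat \<Rightarrow> nat \<Rightarrow> nat \<Rightarrow> ((nat \<Rightarrow> int) set \<Rightarrow> complex) \<Rightarrow> bool" where
  "faithful_character p r q \<chi> \<longleftrightarrow>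
    \<chi> \<in> hom (principal_units_quotient p r q) circle_group \<and>
    inj_on \<chi> (carrier (principal_units_quotient p r q))"

abbreviation Rq :: "nat \<Rightarrow> nat \<Rightarrow> int ring" where
  "Rq p q \<equiv> residue_ring (int p ^ q)"

text \<open>The coset of \<open>1 + p ^ r * a * b\<close> depends only on \<open>a\<close> and \<open>b\<close> modulo \<open>p ^ q\<close>.\<close>

definition Hmat ::
    "nat \<Rightarrow> nat \<Rightarrow> nat \<Rightarrow> ((nat \<Rightarrow> int) set \<Rightarrow> complex) \<Rightarrow> int \<Rightarrow> int \<Rightarrow> complex" where
  "Hmat p r q \<chi> a b =
    \<chi> (principal_units p (q + r) #>\<^bsub>principal_units_group p r\<^esub> Zp_of_int p (1 + int p ^ r * a * b))"

type_synonym quad = "(int \<Rightarrow> int) \<times> (int \<Rightarrow> int) \<times> (int \<Rightarrow> complex) \<times> (int \<Rightarrow> complex)"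

text \<open>All four components are extensional functions on \<open>R\<^sub>q\<close>. The scalar components of a product
  are the ones forced by substituting one defining equation into the other, given that the
  permutations compose as \<open>\<pi> \<circ> \<pi>'\<close> and \<open>\<sigma>' \<circ> \<sigma>\<close>.\<close>

definition quad_group ::
    "nat \<Rightarrow> nat \<Rightarrow> nat \<Rightarrow> ((nat \<Rightarrow> int) set \<Rightarrow> complex) \<Rightarrow> quad monoid" where
  "quad_group p r q \<chi> = (let R = carrier (Rq p q) in
    \<lparr>carrier = {(\<pi>, \<sigma>, \<alpha>, \<omega>).
        \<pi> \<in> Bij R \<and> \<sigma> \<in> Bij R \<and>
        \<alpha> \<in> R \<rightarrow>\<^sub>E {z. cmod z = 1} \<and> \<omega> \<in> R \<rightarrow>\<^sub>E {z. cmod z = 1} \<and>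
        (\<forall>a\<in>R. \<forall>b\<in>R. Hmat p r q \<chi> a (\<sigma> b) * \<omega> b = \<alpha> a * Hmat p r q \<chi> (\<pi> a) b)},
     monoid.mult = \<lambda>(\<pi>, \<sigma>, \<alpha>, \<omega>) (\<pi>', \<sigma>', \<alpha>', \<omega>').
       (compose R \<pi> \<pi>', compose R \<sigma>' \<sigma>,
        \<lambda>a\<in>R. \<alpha>' a * \<alpha> (\<pi>' a), \<lambda>b\<in>R. \<omega> b * \<omega>' (\<sigma> b)),
     one = (\<lambda>a\<in>R. a, \<lambda>b\<in>R. b, \<lambda>a\<in>R. 1, \<lambda>b\<in>R. 1)\<rparr>)"

definition scalar_quads :: "nat \<Rightarrow> nat \<Rightarrow> quad set" where
  "scalar_quads p q = (let R = carrier (Rq p q) in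
    {(\<lambda>a\<in>R. a, \<lambda>b\<in>R. b, \<lambda>a\<in>R. \<zeta>, \<lambda>b\<in>R. \<zeta>) | \<zeta>. cmod \<zeta> = 1})"

text \<open>The coset of \<open>(\<pi>, \<sigma>, \<alpha>, \<omega>)\<close> is its class \<open>{(\<pi>, \<sigma>, \<zeta> \<alpha>, \<zeta> \<omega>) | cmod \<zeta> = 1}\<close>.\<close>

definition proj_mon_aut ::
    "nat \<Rightarrow> nat \<Rightarrow> nat \<Rightarrow> ((nat \<Rightarrow> int) set \<Rightarrow> complex) \<Rightarrow> quad set monoid" where
  "proj_mon_aut p r q \<chi> = quad_group p r q \<chi> Mod scalar_quads p q"

section \<open>Triples, transition maps and the inverse limit\<close>

definition triples :: "nat \<Rightarrow> nat \<Rightarrow> (int \<times> int \<times> int) set" where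
  "triples p q = carrier (Rq p q) \<times> carrier (Rq p q) \<times> Units (Rq p q)"

definition moebius :: "nat \<Rightarrow> nat \<Rightarrow> nat \<Rightarrow> int \<Rightarrow> int \<Rightarrow> int \<Rightarrow> int \<Rightarrow> int" where
  "moebius p r q u l v x =
    (u \<oplus>\<^bsub>Rq p q\<^esub> l \<otimes>\<^bsub>Rq p q\<^esub> x) \<otimes>\<^bsub>Rq p q\<^esub>
    inv\<^bsub>Rq p q\<^esub> (\<one>\<^bsub>Rq p q\<^esub> \<oplus>\<^bsub>Rq p q\<^esub> (int p ^ r mod int p ^ q) \<otimes>\<^bsub>Rq p q\<^esub> v \<otimes>\<^bsub>Rq p q\<^esub> x)"

fun col_map :: "nat \<Rightarrow> nat \<Rightarrow> nat \<Rightarrow> int \<times> int \<times> int \<Rightarrow> int \<Rightarrow> int" where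
  "col_map p r q (c, s, l) b = moebius p r q s l c b"

fun row_map :: "nat \<Rightarrow> nat \<Rightarrow> nat \<Rightarrow> int \<times> int \<times> int \<Rightarrow> int \<Rightarrow> int" where
  "row_map p r q (c, s, l) a = moebius p r q c l s a"

fun triple_quad ::
    "nat \<Rightarrow> nat \<Rightarrow> nat \<Rightarrow> ((nat \<Rightarrow> int) set \<Rightarrow> complex) \<Rightarrow> int \<times> int \<times> int \<Rightarrow> quad" where
  "triple_quad p r q \<chi> (c, s, l) = (let R = carrier (Rq p q) in
    (\<lambda>a\<in>R. row_map p r q (c, s, l) a, \<lambda>b\<in>R. col_map p r q (c, s, l) b,
     \<lambda>a\<in>R. Hmat p r q \<chi> a s, \<lambda>b\<in>R. Hmat p r q \<chi> c b))"

definition triple_class ::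
    "nat \<Rightarrow> nat \<Rightarrow> nat \<Rightarrow> ((nat \<Rightarrow> int) set \<Rightarrow> complex) \<Rightarrow> int \<times> int \<times> int \<Rightarrow> quad set" where
  "triple_class p r q \<chi> t = scalar_quads p q #>\<^bsub>quad_group p r q \<chi>\<^esub> triple_quad p r q \<chi> t"

fun reduce_triple :: "nat \<Rightarrow> nat \<Rightarrow> int \<times> int \<times> int \<Rightarrow> int \<times> int \<times> int" where
  "reduce_triple p q (c, s, l) = (c mod int p ^ q, s mod int p ^ q, l mod int p ^ q)"

text \<open>The characters at the different levels are unrelated to each other.\<close>

definition transition ::
    "nat \<Rightarrow> nat \<Rightarrow> (nat \<Rightarrow> (nat \<Rightarrow> int) set \<Rightarrow> complex) \<Rightarrow> nat \<Rightarrow> quad set \<Rightarrow> quad set" where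
  "transition p r \<chi> q Q = triple_class p r (q - 1) (\<chi> (q - 1))
     (reduce_triple p (q - 1) (THE t. t \<in> triples p q \<and> Q = triple_class p r q (\<chi> q) t))"

text \<open>The limit of \<open>\<dots> \<rightarrow> G 2 \<rightarrow> G 1\<close>, where \<open>f q\<close> maps \<open>G q\<close> to \<open>G (q - 1)\<close>.\<close>

definition inverse_limit ::
    "(nat \<Rightarrow> 'a monoid) \<Rightarrow> (nat \<Rightarrow> 'a \<Rightarrow> 'a) \<Rightarrow> (nat \<Rightarrow> 'a) monoid" where
  "inverse_limit G f = (product_group {1..} G)
    \<lparr>carrier := {x \<in> carrier (product_group {1..} G). \<forall>q\<ge>2. f q (x q) = x (q - 1)}\<rparr>"

section \<open>Two-by-two matrices and the projective linear group\<close>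

datatype 'a mat2 = Mat2 (m11: 'a) (m12: 'a) (m21: 'a) (m22: 'a)

definition mat2_monoid :: "('a, 'm) ring_scheme \<Rightarrow> 'a mat2 monoid" where
  "mat2_monoid R =
    \<lparr>carrier = {A. set_mat2 A \<subseteq> carrier R},
     monoid.mult = \<lambda>A B. Mat2
       (m11 A \<otimes>\<^bsub>R\<^esub> m11 B \<oplus>\<^bsub>R\<^esub> m12 A \<otimes>\<^bsub>R\<^esub> m21 B) (m11 A \<otimes>\<^bsub>R\<^esub> m12 B \<oplus>\<^bsub>R\<^esub> m12 A \<otimes>\<^bsub>R\<^esub> m22 B)
       (m21 A \<otimes>\<^bsub>R\<^esub> m11 B \<oplus>\<^bsub>R\<^esub> m22 A \<otimes>\<^bsub>R\<^esub> m21 B) (m21 A \<otimes>\<^bsub>R\<^esub> m12 B \<oplus>\<^bsub>R\<^esub> m22 A \<otimes>\<^bsub>R\<^esub> m22 B),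
     one = Mat2 \<one>\<^bsub>R\<^esub> \<zero>\<^bsub>R\<^esub> \<zero>\<^bsub>R\<^esub> \<one>\<^bsub>R\<^esub>\<rparr>"

definition GL2 :: "('a, 'm) ring_scheme \<Rightarrow> 'a mat2 monoid" where
  "GL2 R = units_of (mat2_monoid R)"

definition scalar_mats :: "('a, 'm) ring_scheme \<Rightarrow> 'a mat2 set" where
  "scalar_mats R = {Mat2 u \<zero>\<^bsub>R\<^esub> \<zero>\<^bsub>R\<^esub> u | u. u \<in> Units R}"

text \<open>For a local ring such as \<open>Zp p\<close> this quotient is the group of points of the scheme
  \<open>PGL\<^sub>2\<close>.\<close>

definition PGL2 :: "('a, 'm) ring_scheme \<Rightarrow> 'a mat2 set monoid" where
  "PGL2 R = GL2 R Mod scalar_mats R"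

definition PGL2_class :: "('a, 'm) ring_scheme \<Rightarrow> 'a mat2 \<Rightarrow> 'a mat2 set" where
  "PGL2_class R A = scalar_mats R #>\<^bsub>GL2 R\<^esub> A"

definition limit_matrix_classes :: "nat \<Rightarrow> nat \<Rightarrow> (nat \<Rightarrow> int) mat2 set set" where
  "limit_matrix_classes p r =
    {PGL2_class (Zp p) (Mat2 l s (Zp_of_int p (int p ^ r) \<otimes>\<^bsub>Zp p\<^esub> c) \<one>\<^bsub>Zp p\<^esub>) | c s l.
      c \<in> carrier (Zp p) \<and> s \<in> carrier (Zp p) \<and> l \<in> Units (Zp p)}"

definition Gamma0_classes :: "nat \<Rightarrow> nat \<Rightarrow> (nat \<Rightarrow> int) mat2 set set" where
  "Gamma0_classes p r =
    {PGL2_class (Zp p) A | A. A \<in> carrier (GL2 (Zp p)) \<and> enat r \<le> padic_val p (m21 A)}"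

end

theory Submission
  imports Defs
begin

text \<open>Since the character is faithful, the equation \<open>H\<^sub>a(\<sigma>(b)) \<omega>(b) = \<alpha>\<^sub>a H\<^bsub>\<pi>(a)\<^esub>(b)\<close> is a
  congruence modulo \<open>p ^ q\<close>, and its instances with \<open>a\<close> or \<open>b\<close> in \<open>{0, 1}\<close> force the triple
  form of every automorphism. Composing the row permutations multiplies the matrices with rows
  \<open>(\<lambda>, c)\<close> and \<open>(p ^ r s, 1)\<close> up to the scalar \<open>u = 1 + p ^ r s c'\<close>, a unit because \<open>r \<ge> 1\<close>.
  A compatible family of triples is a triple of p-adic integers, and the group law, being a
  congruence at every level, is an identity over the p-adic integers. Hence triples over
  the p-adic integers parametrize both the inverse limit and the matrix classes,
  with the same multiplication. A matrix whose lower-left entry is divisible by \<open>p ^ r\<close> has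
  unit diagonal entries, so it can be scaled to have lower-right entry 1.\<close>

section \<open>Arithmetic in the ring of p-adic integers\<close>

text \<open>The scalar components are the obstacle to a direct check of the group law. The quadruple
  of a triple is normalised by \<open>\<omega> 0 = 1\<close>, but in a product of two of them the
  column scalar at 0 is \<open>E (c' * s)\<close>, the character value at
  \<open>1 + p ^ r s c'\<close>, so the product is the quadruple of a triple only up to a scalar.
  These scalars are never tracked. Each class comes from a triple, and the permutations alone give
  that triple back: \<open>c\<close> is the value of the row permutation at 0, \<open>s\<close> that
  of the column permutation at 0, and \<open>l\<close> follows from the row permutation at 1. So two
  classes are equal as soon as three values of their permutations agree, and a product of classes is
  identified by composing permutations.\<close>

lemma Zp_carrier_iff:
  "x \<in> carrier (Zp p) \<longleftrightarrow> (\<forall>n. 0 \<le> x n \<and> x n < int p ^ n \<and> x (Suc n) mod int p ^ n = x n)"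
  by (auto simp: Zp_def)

lemma Zp_mult: "(x \<otimes>\<^bsub>Zp p\<^esub> y) n = (x n * y n) mod int p ^ n"
  and Zp_add: "(x \<oplus>\<^bsub>Zp p\<^esub> y) n = (x n + y n) mod int p ^ n"
  and Zp_one: "\<one>\<^bsub>Zp p\<^esub> n = 1 mod int p ^ n"
  and Zp_zero: "\<zero>\<^bsub>Zp p\<^esub> n = 0"
  by (simp_all add: Zp_def)

lemmas Zp_ops = Zp_mult Zp_add Zp_one Zp_zero

lemma Zp_mod_self: "x \<in> carrier (Zp p) \<Longrightarrow> x n mod int p ^ n = x n"
  by (simp add: Zp_carrier_iff)

lemma Zp_mod_Suc: "x \<in> carrier (Zp p) \<Longrightarrow> x (Suc n) mod int p ^ n = x n"
  by (simp add: Zp_carrier_iff)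

lemma Zp_at_0: "x \<in> carrier (Zp p) \<Longrightarrow> x 0 = 0"
  using Zp_mod_self[of x p 0] by simp

lemma Zp_mod_le:
  assumes "x \<in> carrier (Zp p)" "m \<le> n"
  shows "x n mod int p ^ m = x m"
  using assms(2)
proof (induction n rule: dec_induct)
  case base
  then show ?case by (simp add: Zp_mod_self assms)
next
  case (step n)
  have "x (Suc n) mod int p ^ m = (x (Suc n) mod int p ^ n) mod int p ^ m"
    using step.hyps by (simp add: mod_mod_cancel le_imp_power_dvd)
  then show ?case using step by (simp add: Zp_mod_Suc assms)
qed

text \<open>Entries can be built as arbitrary integers and reduced afterwards, so that sums,
  negatives and levelwise inverses need only congruences between neighbouring levels.\<close>

lemma Zp_memI:
  assumes "p > 0" "\<And>n. [f (Suc n) = f n] (mod int p ^ n)"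
  shows "(\<lambda>n. f n mod int p ^ n) \<in> carrier (Zp p)"
  using assms by (auto simp: Zp_carrier_iff mod_mod_cancel cong_def)

lemma Zp_cong_Suc: "x \<in> carrier (Zp p) \<Longrightarrow> [x (Suc n) = x n] (mod int p ^ n)"
  by (simp add: cong_def Zp_mod_Suc Zp_mod_self)

lemma Zp_eqI:
  assumes "x \<in> carrier (Zp p)" "y \<in> carrier (Zp p)" "\<And>n. [x n = y n] (mod int p ^ n)"
  shows "x = y"
proof
  fix n show "x n = y n"
    using assms(3)[of n] by (simp add: cong_def Zp_mod_self assms)
qed

lemma Zp_cring:
  assumes "p > 0"
  shows "cring (Zp p)"
proof -
  have add: "x \<oplus>\<^bsub>Zp p\<^esub> y \<in> carrier (Zp p)" and mult: "x \<otimes>\<^bsub>Zp p\<^esub> y \<in> carrier (Zp p)"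
    if "x \<in> carrier (Zp p)" "y \<in> carrier (Zp p)" for x y
    using Zp_memI[OF assms, of "\<lambda>n. x n + y n"] Zp_memI[OF assms, of "\<lambda>n. x n * y n"] that
    by (simp_all add: Zp_def cong_add cong_mult Zp_cong_Suc[unfolded Zp_def])
  have neg: "(\<lambda>n. (- x n) mod int p ^ n) \<in> carrier (Zp p)" if "x \<in> carrier (Zp p)" for x
    by (intro Zp_memI assms) (simp add: cong_minus_minus_iff Zp_cong_Suc that)
  have one: "\<one>\<^bsub>Zp p\<^esub> \<in> carrier (Zp p)"
    using Zp_memI[OF assms, of "\<lambda>n. 1"] by (simp add: Zp_def)
  have zero: "\<zero>\<^bsub>Zp p\<^esub> \<in> carrier (Zp p)"
    using assms by (simp add: Zp_carrier_iff Zp_zero)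
  show ?thesis
  proof (intro cringI abelian_groupI comm_monoidI)
    fix x assume x: "x \<in> carrier (Zp p)"
    show "\<exists>y\<in>carrier (Zp p). y \<oplus>\<^bsub>Zp p\<^esub> x = \<zero>\<^bsub>Zp p\<^esub>"
      using neg[OF x] by (rule bexI[rotated]) (simp add: fun_eq_iff Zp_ops mod_simps)
  qed (auto intro: add mult one zero simp: fun_eq_iff Zp_ops mod_simps Zp_mod_self algebra_simps)
qed

lemma Zp_minus:
  assumes "p > 0" "x \<in> carrier (Zp p)"
  shows "(\<ominus>\<^bsub>Zp p\<^esub> x) n = (- x n) mod int p ^ n"
proof -
  interpret cring "Zp p" by (rule Zp_cring[OF assms(1)])
  have "(\<lambda>n. (- x n) mod int p ^ n) \<in> carrier (Zp p)"
    by (intro Zp_memI assms) (simp add: cong_minus_minus_iff Zp_cong_Suc assms)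
  moreover have "(\<lambda>n. (- x n) mod int p ^ n) \<oplus>\<^bsub>Zp p\<^esub> x = \<zero>\<^bsub>Zp p\<^esub>"
    by (simp add: fun_eq_iff Zp_ops mod_simps)
  ultimately have "\<ominus>\<^bsub>Zp p\<^esub> x = (\<lambda>n. (- x n) mod int p ^ n)"
    using assms(2) minus_equality by auto
  then show ?thesis by simp
qed

lemma Zp_of_int_closed: "p > 0 \<Longrightarrow> Zp_of_int p k \<in> carrier (Zp p)"
  unfolding Zp_of_int_def by (rule Zp_memI) auto

lemma Zp_of_int_mult: "Zp_of_int p (a * b) = Zp_of_int p a \<otimes>\<^bsub>Zp p\<^esub> Zp_of_int p b"
  by (simp add: fun_eq_iff Zp_of_int_def Zp_ops mod_simps)

lemma Zp_of_int_at: "Zp_of_int p k n = k mod int p ^ n"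
  by (simp add: Zp_of_int_def)

lemma coprime_prime_power_int_iff:
  assumes "Factorial_Ring.prime (p::nat)" "n \<ge> 1"
  shows "coprime k (int p ^ n) \<longleftrightarrow> \<not> int p dvd k"
proof -
  have "Factorial_Ring.prime (int p)" using assms by simp
  then have "coprime (int p) k \<longleftrightarrow> \<not> int p dvd k"
    by (metis coprime_absorb_left not_prime_unit prime_imp_coprime)
  then show ?thesis
    using assms(2) by (simp add: coprime_power_right_iff coprime_commute)
qed

lemma Zp_coprime:
  assumes "Factorial_Ring.prime (p::nat)" "x \<in> carrier (Zp p)" "\<not> int p dvd x 1"
  shows "coprime (x n) (int p ^ n)"
proof (cases "n = 0")
  case False
  have "x n mod int p ^ 1 = x 1"
    using False by (intro Zp_mod_le assms) auto
  then have "\<not> int p dvd x n"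
    using assms(3) by (metis dvd_mod_iff dvd_refl power_one_right)
  then show ?thesis
    using False assms by (subst coprime_prime_power_int_iff) auto
qed auto

text \<open>Non-divisibility by \<open>p\<close> at level 1 makes every entry invertible at its own
  level. The levelwise inverses are chosen independently, but they are unique modulo
  \<open>p ^ n\<close> and therefore fit together.\<close>

lemma Zp_Units_iff:
  assumes p: "Factorial_Ring.prime (p::nat)"
  shows "x \<in> Units (Zp p) \<longleftrightarrow> x \<in> carrier (Zp p) \<and> \<not> int p dvd x 1"
proof -
  have p0: "p > 0" and p1: "int p > 1"
    using prime_gt_0_nat[OF p] prime_gt_1_nat[OF p] by auto
  interpret cring "Zp p" by (rule Zp_cring[OF p0])
  show ?thesis
  proof (intro iffI conjI; (elim conjE)?)
    assume x: "x \<in> Units (Zp p)"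
    then show "x \<in> carrier (Zp p)" by blast
    from x obtain y where "x \<otimes>\<^bsub>Zp p\<^esub> y = \<one>\<^bsub>Zp p\<^esub>"
      unfolding Units_def by blast
    then have "(x \<otimes>\<^bsub>Zp p\<^esub> y) 1 = \<one>\<^bsub>Zp p\<^esub> 1"
      by simp
    then have "(x 1 * y 1) mod int p = 1"
      using p1 by (simp add: Zp_ops)
    then show "\<not> int p dvd x 1"
      using p1 by auto
  next
    assume x: "x \<in> carrier (Zp p)" and nd: "\<not> int p dvd x 1"
    note cop = Zp_coprime[OF p x nd]
    have "\<exists>y. [x n * y = 1] (mod int p ^ n)" for n
      using cop[of n] by (simp add: cong_solve_coprime_int)
    then obtain y where y: "[x n * y n = 1] (mod int p ^ n)" for n
      by metis
    have "[y (Suc n) = y n] (mod int p ^ n)" for n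
    proof -
      have "[x (Suc n) * y (Suc n) = 1] (mod int p ^ n)"
        using y[of "Suc n"] by (rule cong_dvd_modulus) (simp add: le_imp_power_dvd)
      then have "[x n * y (Suc n) = 1] (mod int p ^ n)"
        using Zp_cong_Suc[OF x, of n] by (meson cong_scalar_right cong_sym cong_trans)
      then have "[x n * y (Suc n) = x n * y n] (mod int p ^ n)"
        using y[of n] by (meson cong_sym cong_trans)
      then show ?thesis
        using cop[of n] by (simp add: cong_mult_lcancel)
    qed
    then have mem: "(\<lambda>n. y n mod int p ^ n) \<in> carrier (Zp p)" (is "?y \<in> _")
      by (intro Zp_memI p0)
    have "x \<otimes>\<^bsub>Zp p\<^esub> ?y = \<one>\<^bsub>Zp p\<^esub>"
      using y by (simp add: fun_eq_iff Zp_ops mod_simps cong_def)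
    then show "x \<in> Units (Zp p)"
      using x mem m_comm[OF mem x] unfolding Units_def by (auto intro!: bexI[of _ ?y])
  qed
qed

lemma Zp_power_divides_iff:
  assumes "p > 0" "x \<in> carrier (Zp p)"
  shows "Zp_of_int p (int p ^ n) divides\<^bsub>Zp p\<^esub> x \<longleftrightarrow> x n = 0"
proof
  assume "Zp_of_int p (int p ^ n) divides\<^bsub>Zp p\<^esub> x"
  then show "x n = 0"
    by (auto simp: factor_def Zp_mult Zp_of_int_at)
next
  assume x0: "x n = 0"
  have dvd: "int p ^ n dvd x (m + n)" for m
    using Zp_mod_le[OF assms(2), of n "m + n"] x0 by (simp add: mod_eq_0_iff_dvd)
  \<comment> \<open>Division by \<open>p ^ n\<close> loses \<open>n\<close> digits, so the entry of
    the quotient at \<open>m\<close> is taken from the entry of \<open>x\<close> at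
    \<open>m + n\<close>.\<close>
  define y where "y m = x (m + n) div int p ^ n" for m
  have y: "int p ^ n * y m = x (m + n)" for m
    using dvd[of m] by (simp add: y_def)
  have pn: "int p ^ n > 0" using assms(1) by simp
  have "y \<in> carrier (Zp p)"
    unfolding Zp_carrier_iff
  proof (intro allI conjI)
    fix m
    have "0 \<le> x (m + n)" "x (m + n) < int p ^ (m + n)"
      using assms(2) by (simp_all add: Zp_carrier_iff)
    then have "int p ^ n * 0 \<le> int p ^ n * y m" "int p ^ n * y m < int p ^ n * int p ^ m"
      unfolding y power_add[symmetric] by (simp_all add: add.commute)
    then show "0 \<le> y m" "y m < int p ^ m"
      using pn by (simp_all only: mult_le_cancel_left_pos mult_less_cancel_left_pos)
    have "int p ^ n * (y (Suc m) mod int p ^ m) = x (Suc (m + n)) mod int p ^ (m + n)"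
      using y[of "Suc m"] by (simp add: mult_mod_right power_add mult.commute)
    also have "\<dots> = int p ^ n * y m"
      by (simp add: Zp_mod_Suc assms(2) y)
    finally show "y (Suc m) mod int p ^ m = y m"
      using assms(1) by auto
  qed
  moreover have "x = Zp_of_int p (int p ^ n) \<otimes>\<^bsub>Zp p\<^esub> y"
    by (simp add: fun_eq_iff Zp_mult Zp_of_int_at mod_simps y Zp_mod_le assms(2))
  ultimately show "Zp_of_int p (int p ^ n) divides\<^bsub>Zp p\<^esub> x"
    unfolding factor_def by blast
qed

text \<open>The levels at which \<open>x\<close> vanishes form an initial segment of the naturals,
  so the supremum is compared with \<open>n\<close> by looking at one entry.\<close>

lemma le_padic_val_iff:
  assumes "p > 0" "x \<in> carrier (Zp p)"
  shows "enat n \<le> padic_val p x \<longleftrightarrow> x n = 0"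
proof
  assume *: "enat n \<le> padic_val p x"
  show "x n = 0"
  proof (rule ccontr)
    assume nz: "x n \<noteq> 0"
    \<comment> \<open>Every p-adic integer vanishes at level 0, so \<open>n - 1\<close> below is a
      true predecessor.\<close>
    then have n: "n > 0"
      using Zp_at_0[OF assms(2)] by (cases n) auto
    have "m \<le> n - 1" if "x m = 0" for m
      using Zp_mod_le[OF assms(2), of n m] that nz by (cases "n \<le> m") auto
    then have "padic_val p x \<le> enat (n - 1)"
      unfolding padic_val_def Zp_power_divides_iff[OF assms] by (intro SUP_least) auto
    also have "\<dots> < enat n" using n by simp
    finally show False using * by simp
  qed
next
  assume "x n = 0"
  then show "enat n \<le> padic_val p x"
    unfolding padic_val_def Zp_power_divides_iff[OF assms] by (intro SUP_upper) auto
qed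

section \<open>Moebius maps and triples\<close>

lemma residue_ring_Units:
  assumes "m > 1"
  shows "Units (residue_ring m) = {x. 0 \<le> x \<and> x < m \<and> coprime x m}"
proof -
  have "\<not> coprime 0 m" using assms by simp
  then have "0 < x \<and> x < m \<and> coprime x m \<longleftrightarrow> 0 \<le> x \<and> x < m \<and> coprime x m" for x
    by (metis le_less)
  then show ?thesis
    by (simp only: residues.res_units_eq[OF residues.intro[OF assms]])
qed

text \<open>The group law on triples with the denominator \<open>1 + k s c'\<close> cleared: in this form it visibly
  survives reduction to a smaller modulus.\<close>

fun triple_prod :: "int \<Rightarrow> int \<Rightarrow> int \<times> int \<times> int \<Rightarrow> int \<times> int \<times> int \<Rightarrow> int \<times> int \<times> int \<Rightarrow> bool" where
  "triple_prod m k (c, s, l) (c', s', l') (c'', s'', l'') \<longleftrightarrow>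
    [(1 + k * s * c') * c'' = c + l * c'] (mod m) \<and>
    [(1 + k * s * c') * s'' = l' * s + s'] (mod m) \<and>
    [(1 + k * s * c') * l'' = l * l' + k * c * s'] (mod m)"

locale prime_power =
  fixes p r q :: nat
  assumes prime: "Factorial_Ring.prime p" and r: "r \<ge> 1" and q: "q \<ge> 1"
begin

abbreviation "m \<equiv> int p ^ q"
abbreviation "k \<equiv> int p ^ r"
abbreviation "S \<equiv> carrier (Rq p q)"

lemma p_pos: "p > 0" and p_gt_1: "int p > 1"
  using prime_gt_0_nat[OF prime] prime_gt_1_nat[OF prime] by auto

lemma m_gt_1: "m > 1"
  using p_gt_1 q by (simp add: one_less_power)

lemma m_pos: "m > 0"
  using p_pos by simp

lemma S_eq: "S = {0..<m}"
  by (simp add: residue_ring_def atLeastLessThanPlusOne_atLeastAtMost_int[symmetric])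

lemma coprime_m_iff: "coprime x m \<longleftrightarrow> \<not> int p dvd x"
  by (rule coprime_prime_power_int_iff[OF prime q])

lemma Units_eq: "Units (Rq p q) = {x. 0 \<le> x \<and> x < m \<and> \<not> int p dvd x}"
  unfolding residue_ring_Units[OF m_gt_1] coprime_m_iff by (rule refl)

lemma triples_iff:
  "(c, s, l) \<in> triples p q \<longleftrightarrow>
    0 \<le> c \<and> c < m \<and> 0 \<le> s \<and> s < m \<and> 0 \<le> l \<and> l < m \<and> \<not> int p dvd l"
  unfolding triples_def S_eq Units_eq by simp

lemma p_dvd_k: "int p dvd k"
  using r by simp

lemma coprime_1_plus: "coprime (1 + k * x) m"
proof -
  have "int p dvd k * x" using p_dvd_k by simp
  then have "\<not> int p dvd 1 + k * x"
    using p_gt_1 by (simp add: dvd_add_left_iff)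
  then show ?thesis unfolding coprime_m_iff .
qed

lemma mem_eqI: "x \<in> S \<Longrightarrow> y \<in> S \<Longrightarrow> [x = y] (mod m) \<Longrightarrow> x = y"
  by (simp add: S_eq cong_def)

lemma ex_cong_solution:
  obtains y where "y \<in> S" "[(1 + k * x) * y = z] (mod m)"
proof -
  obtain w where w: "[(1 + k * x) * w = 1] (mod m)"
    using coprime_1_plus cong_solve_coprime_int by blast
  have "[(1 + k * x) * ((w * z) mod m) = ((1 + k * x) * w) * z] (mod m)"
    by (simp add: cong_def mod_simps mult.assoc)
  also have "[((1 + k * x) * w) * z = 1 * z] (mod m)"
    using w by (rule cong_scalar_right)
  finally show ?thesis
    using that[of "(w * z) mod m"] m_pos by (simp add: S_eq)
qed

lemma cong_cancel_1_plus:
  "[(1 + k * x) * a = (1 + k * x) * b] (mod m) \<Longrightarrow> [a = b] (mod m)"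
  using coprime_1_plus by (simp add: cong_mult_lcancel)

text \<open>Together with \<open>moebius_eqI\<close> this replaces the inverse in the residue ring
  by a congruence with the denominator cleared, the form in which Moebius maps are handled from here
  on.\<close>

lemma moebius_cong: "[(1 + k * (v * x)) * moebius p r q u l v x = u + l * x] (mod m)"
  and moebius_mem: "moebius p r q u l v x \<in> S"
proof -
  interpret cring "Rq p q"
    by (intro residues.cring residues.intro m_gt_1)
  define D where "D = (1 + k * (v * x)) mod m"
  have D_eq: "\<one>\<^bsub>Rq p q\<^esub> \<oplus>\<^bsub>Rq p q\<^esub> (k mod m) \<otimes>\<^bsub>Rq p q\<^esub> v \<otimes>\<^bsub>Rq p q\<^esub> x = D"
    by (simp add: D_def residue_ring_def mod_simps mult.assoc)
  have "coprime D m"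
    unfolding D_def using coprime_1_plus m_pos by (subst coprime_mod_left_iff) auto
  then have DU: "D \<in> Units (Rq p q)"
    unfolding residue_ring_Units[OF m_gt_1] D_def
    using pos_mod_sign[OF m_pos] pos_mod_bound[OF m_pos] by blast
  define I where "I = inv\<^bsub>Rq p q\<^esub> D"
  have DI: "[D * I = 1] (mod m)"
    using Units_r_inv[OF DU] m_gt_1 by (simp add: I_def residue_ring_def cong_def)
  have mo: "moebius p r q u l v x = ((u + l * x) * I) mod m"
    unfolding moebius_def D_eq I_def[symmetric] by (simp add: residue_ring_def mod_simps)
  show "moebius p r q u l v x \<in> S"
    using m_pos by (simp add: mo S_eq)
  have "[1 + k * (v * x) = D] (mod m)" "[moebius p r q u l v x = (u + l * x) * I] (mod m)"
    unfolding mo D_def by (simp_all add: cong_def)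
  then have "[(1 + k * (v * x)) * moebius p r q u l v x = D * ((u + l * x) * I)] (mod m)"
    by (rule cong_mult)
  also have "D * ((u + l * x) * I) = D * I * (u + l * x)"
    by simp
  also have "[D * I * (u + l * x) = 1 * (u + l * x)] (mod m)"
    using DI by (rule cong_scalar_right)
  finally show "[(1 + k * (v * x)) * moebius p r q u l v x = u + l * x] (mod m)"
    by (simp only: mult_1)
qed

lemma moebius_eqI:
  assumes "y \<in> S" "[(1 + k * (v * x)) * y = u + l * x] (mod m)"
  shows "moebius p r q u l v x = y"
proof -
  have "[(1 + k * (v * x)) * moebius p r q u l v x = (1 + k * (v * x)) * y] (mod m)"
    using moebius_cong cong_sym[OF assms(2)] by (rule cong_trans)
  then have "[moebius p r q u l v x = y] (mod m)"
    by (rule cong_cancel_1_plus)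
  with moebius_mem assms(1) show ?thesis
    by (rule mem_eqI)
qed

lemma moebius_0: "u \<in> S \<Longrightarrow> moebius p r q u l v 0 = u"
  by (rule moebius_eqI) auto

text \<open>Cross multiplication of the two fractions leaves \<open>x - y\<close> times the
  determinant \<open>l - k * (v * u)\<close> of the map, and the determinant is prime to
  \<open>p\<close> because \<open>p\<close> divides \<open>k\<close> but not
  \<open>l\<close>.\<close>

lemma moebius_inj:
  assumes l: "\<not> int p dvd l" and xy: "x \<in> S" "y \<in> S"
    and eq: "moebius p r q u l v x = moebius p r q u l v y"
  shows "x = y"
proof -
  let ?z = "moebius p r q u l v x"
  have "[(1 + k * (v * x)) * ?z = u + l * x] (mod m)" "[(1 + k * (v * y)) * ?z = u + l * y] (mod m)"
    using moebius_cong[of v x u l] moebius_cong[of v y u l] eq by simp_all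
  from cong_diff[OF cong_scalar_left[OF this(1)] cong_scalar_left[OF this(2)]]
  have "[(1 + k * (v * y)) * ((1 + k * (v * x)) * ?z) - (1 + k * (v * x)) * ((1 + k * (v * y)) * ?z)
     = (1 + k * (v * y)) * (u + l * x) - (1 + k * (v * x)) * (u + l * y)] (mod m)"
    .
  also have "(1 + k * (v * y)) * ((1 + k * (v * x)) * ?z) - (1 + k * (v * x)) * ((1 + k * (v * y)) * ?z)
     = (l - k * (v * u)) * 0"
    by simp
  also have "(1 + k * (v * y)) * (u + l * x) - (1 + k * (v * x)) * (u + l * y)
     = (l - k * (v * u)) * (x - y)"
    by (simp add: algebra_simps)
  finally have "[(l - k * (v * u)) * 0 = (l - k * (v * u)) * (x - y)] (mod m)" .
  moreover have "coprime (l - k * (v * u)) m"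
    unfolding coprime_m_iff using l p_dvd_k by (simp add: dvd_diff_left_iff)
  ultimately have "[0 = x - y] (mod m)"
    by (simp only: cong_mult_lcancel)
  then have "[y = x] (mod m)"
    by (simp add: cong_iff_dvd_diff dvd_diff_commute)
  then show ?thesis
    using mem_eqI xy cong_sym by blast
qed

lemma moebius_Bij:
  assumes "\<not> int p dvd l"
  shows "(\<lambda>x\<in>S. moebius p r q u l v x) \<in> Bij S"
proof -
  have "inj_on (moebius p r q u l v) S"
    using moebius_inj[OF assms] by (auto intro: inj_onI)
  moreover from this have "moebius p r q u l v ` S = S"
    using moebius_mem by (intro endo_inj_surj) (auto simp: S_eq)
  ultimately show ?thesis
    by (simp add: Bij_def bij_betw_def inj_on_restrict_eq image_restrict_eq)
qed

lemma triple_prod_closed: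
  assumes "t \<in> triples p q" "t' \<in> triples p q"
  obtains t'' where "t'' \<in> triples p q" "triple_prod m k t t' t''"
proof -
  obtain c s l c' s' l' where t: "t = (c, s, l)" "t' = (c', s', l')"
    by (metis prod_cases3)
  obtain c'' where c: "c'' \<in> S" "[(1 + k * (s * c')) * c'' = c + l * c'] (mod m)"
    using ex_cong_solution .
  obtain s'' where s: "s'' \<in> S" "[(1 + k * (s * c')) * s'' = l' * s + s'] (mod m)"
    using ex_cong_solution .
  obtain l'' where l: "l'' \<in> S" "[(1 + k * (s * c')) * l'' = l * l' + k * c * s'] (mod m)"
    using ex_cong_solution .
  \<comment> \<open>Modulo \<open>p\<close> the third congruence reads \<open>l'' = l * l'\<close>,
    since \<open>p\<close> divides \<open>k\<close>; this is how the unit condition passes to the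
    product.\<close>
  have "\<not> int p dvd l * l' + k * c * s'"
    using assms p_dvd_k prime by (simp add: t triples_iff dvd_add_left_iff prime_dvd_mult_iff)
  moreover have "[(1 + k * (s * c')) * l'' = l * l' + k * c * s'] (mod int p)"
    using l(2) by (rule cong_dvd_modulus) (use q in simp)
  ultimately have "\<not> int p dvd l''"
    by (metis cong_dvd_iff dvd_mult)
  with c s l show ?thesis
    by (intro that[of "(c'', s'', l'')"]) (auto simp: t triples_iff S_eq mult.assoc)
qed

lemma triple_prod_row:
  assumes "triple_prod m k t t' t''"
  shows "row_map p r q t'' x = row_map p r q t (row_map p r q t' x)"
proof -
  obtain c s l c' s' l' c'' s'' l'' where t: "t = (c, s, l)" "t' = (c', s', l')" "t'' = (c'', s'', l'')"
    by (metis prod_cases3)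
  define y where "y = row_map p r q t' x"
  define z where "z = row_map p r q t y"
  have y: "[(1 + k * (s' * x)) * y = c' + l' * x] (mod m)"
    and z: "[(1 + k * (s * y)) * z = c + l * y] (mod m)"
    using moebius_cong by (simp_all add: y_def z_def t)
  have C: "[(1 + k * s * c') * c'' = c + l * c'] (mod m)"
    and S: "[(1 + k * s * c') * s'' = l' * s + s'] (mod m)"
    and L: "[(1 + k * s * c') * l'' = l * l' + k * c * s'] (mod m)"
    using assms by (simp_all add: t)
  let ?u = "1 + k * (s * c')" and ?d = "1 + k * (s' * x)"
  have "[?u * ((1 + k * (s'' * x)) * z) = ?u * (c'' + l'' * x)] (mod m)"
  proof -
    \<comment> \<open>The terms from \<open>C\<close>, \<open>S\<close> and \<open>L\<close>
      eliminate the components of \<open>t''\<close>. What is left is the congruence for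
      \<open>z\<close> multiplied by the denominator \<open>?d\<close> of \<open>y\<close>;
      replacing \<open>?d * y\<close> there by \<open>c' + l' * x\<close> produces the coefficient
      \<open>l - k * s * z\<close>.\<close>
    have "?u * ((1 + k * (s'' * x)) * z) - ?u * (c'' + l'' * x) =
      k * x * z * ((1 + k * s * c') * s'' - (l' * s + s')) + ?d * ((1 + k * (s * y)) * z - (c + l * y))
      + (l - k * s * z) * (?d * y - (c' + l' * x)) - ((1 + k * s * c') * c'' - (c + l * c'))
      - x * ((1 + k * s * c') * l'' - (l * l' + k * c * s'))"
      by (simp add: algebra_simps)
    also have "m dvd \<dots>"
      by (intro dvd_diff[OF dvd_diff[OF dvd_add[OF dvd_add[OF dvd_mult dvd_mult] dvd_mult]] dvd_mult]
          C S L y z cong_iff_dvd_diff[THEN iffD1])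
    finally show ?thesis by (simp only: cong_iff_dvd_diff)
  qed
  then have "[(1 + k * (s'' * x)) * z = c'' + l'' * x] (mod m)"
    by (rule cong_cancel_1_plus)
  moreover have "z \<in> S"
    using moebius_mem by (simp add: z_def t)
  ultimately show ?thesis
    unfolding y_def[symmetric] z_def[symmetric] by (simp add: t moebius_eqI)
qed

end

section \<open>Principal units and the character matrix\<close>

text \<open>\<open>x - 1\<close> is a multiple of \<open>p ^ n\<close> exactly when its entry at
  \<open>n\<close> vanishes, so membership is read off from a single entry.\<close>

lemma principal_units_iff:
  assumes "p > 0"
  shows "x \<in> principal_units p n \<longleftrightarrow> x \<in> carrier (Zp p) \<and> x n = 1 mod int p ^ n"
proof -
  interpret cring "Zp p" by (rule Zp_cring[OF assms])
  show ?thesis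
  proof (intro iffI conjI; (elim conjE)?)
    assume "x \<in> principal_units p n"
    then obtain y where y: "y \<in> carrier (Zp p)"
      and x: "x = \<one>\<^bsub>Zp p\<^esub> \<oplus>\<^bsub>Zp p\<^esub> Zp_of_int p (int p ^ n) \<otimes>\<^bsub>Zp p\<^esub> y"
      unfolding principal_units_def by blast
    show "x \<in> carrier (Zp p)"
      using y Zp_of_int_closed[OF assms] by (simp add: x)
    show "x n = 1 mod int p ^ n"
      by (simp add: x Zp_ops Zp_of_int_at)
  next
    assume x: "x \<in> carrier (Zp p)" and x1: "x n = 1 mod int p ^ n"
    let ?z = "x \<ominus>\<^bsub>Zp p\<^esub> \<one>\<^bsub>Zp p\<^esub>"
    have "?z n = 0"
      using x by (simp add: a_minus_def Zp_add Zp_minus assms Zp_one x1 mod_simps)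
    then obtain y where "y \<in> carrier (Zp p)" "?z = Zp_of_int p (int p ^ n) \<otimes>\<^bsub>Zp p\<^esub> y"
      using Zp_power_divides_iff[OF assms, of ?z n] x unfolding factor_def by auto
    moreover have "x = \<one>\<^bsub>Zp p\<^esub> \<oplus>\<^bsub>Zp p\<^esub> ?z"
      using x by (simp add: a_minus_def a_lcomm r_neg)
    ultimately show "x \<in> principal_units p n"
      unfolding principal_units_def by auto
  qed
qed

lemma principal_units_subgroup:
  assumes p: "Factorial_Ring.prime p" and n: "n \<ge> 1"
  shows "subgroup (principal_units p n) (units_of (Zp p))"
proof -
  have p0: "p > 0" and p1: "int p > 1"
    using prime_gt_0_nat[OF p] prime_gt_1_nat[OF p] by auto
  interpret cring "Zp p" by (rule Zp_cring[OF p0])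
  interpret U: group "units_of (Zp p)" by (rule units_group)
  have sub: "principal_units p n \<subseteq> Units (Zp p)"
  proof
    fix x assume "x \<in> principal_units p n"
    then have x: "x \<in> carrier (Zp p)" "x n = 1 mod int p ^ n"
      by (simp_all add: principal_units_iff[OF p0])
    have "x 1 = x n mod int p ^ 1"
      using Zp_mod_le[OF x(1) n] by simp
    also have "\<dots> = 1 mod int p ^ 1"
      unfolding x(2) by (rule mod_mod_cancel) (use n in \<open>simp add: dvd_power\<close>)
    finally show "x \<in> Units (Zp p)"
      using x p1 by (simp add: Zp_Units_iff[OF p])
  qed
  show ?thesis
  proof (rule U.subgroupI)
    show "principal_units p n \<subseteq> carrier (units_of (Zp p))"
      using sub by (simp add: units_of_carrier)
    show "principal_units p n \<noteq> {}"
      using principal_units_iff[OF p0, of "\<one>\<^bsub>Zp p\<^esub>"] by (auto simp: Zp_one)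
  next
    fix x assume x: "x \<in> principal_units p n"
    then have u: "x \<in> Units (Zp p)" using sub by auto
    have "(x \<otimes>\<^bsub>Zp p\<^esub> inv\<^bsub>Zp p\<^esub> x) n = 1 mod int p ^ n"
      using u by (simp add: Zp_one)
    then have "(inv\<^bsub>Zp p\<^esub> x) n mod int p ^ n = 1 mod int p ^ n"
      using x by (simp add: Zp_mult principal_units_iff[OF p0] mod_simps)
    then show "inv\<^bsub>units_of (Zp p)\<^esub> x \<in> principal_units p n"
      using u by (simp add: units_of_inv principal_units_iff[OF p0] Zp_mod_self)
  next
    fix x y assume "x \<in> principal_units p n" "y \<in> principal_units p n"
    then show "x \<otimes>\<^bsub>units_of (Zp p)\<^esub> y \<in> principal_units p n"
      by (simp add: units_of_mult principal_units_iff[OF p0] Zp_mult mod_simps)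
  qed
qed

text \<open>Normality is free in the abelian group of units; the content is the inclusion of the
  deeper group in the shallower one.\<close>

lemma principal_units_normal:
  assumes p: "Factorial_Ring.prime p" and "n \<ge> 1" "n \<le> m"
  shows "principal_units p m \<lhd> principal_units_group p n"
proof -
  have p0: "p > 0" using prime_gt_0_nat[OF p] .
  interpret cring "Zp p" by (rule Zp_cring[OF p0])
  interpret U: comm_group "units_of (Zp p)" by (rule units_comm_group)
  have sub: "principal_units p m \<subseteq> principal_units p n"
  proof
    fix x assume "x \<in> principal_units p m"
    then have x: "x \<in> carrier (Zp p)" "x m = 1 mod int p ^ m"
      by (simp_all add: principal_units_iff[OF p0])
    have "x n = x m mod int p ^ n"
      using Zp_mod_le[OF x(1) assms(3)] by simp
    also have "\<dots> = 1 mod int p ^ n"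
      unfolding x(2) by (rule mod_mod_cancel) (use assms in \<open>simp add: le_imp_power_dvd\<close>)
    finally show "x \<in> principal_units p n"
      using x by (simp add: principal_units_iff[OF p0])
  qed
  have n: "subgroup (principal_units p n) (units_of (Zp p))"
    and m: "subgroup (principal_units p m) (units_of (Zp p))"
    using assms by (auto intro: principal_units_subgroup)
  show ?thesis
    unfolding principal_units_group_def
    by (rule U.normal_restrict_supergroup[OF n U.subgroup_imp_normal[OF m] sub])
qed

locale character_matrix = prime_power +
  fixes \<chi> :: "(nat \<Rightarrow> int) set \<Rightarrow> complex"
  assumes faithful: "faithful_character p r q \<chi>"
begin

definition coset :: "int \<Rightarrow> (nat \<Rightarrow> int) set" where
  "coset x = principal_units p (q + r) #>\<^bsub>principal_units_group p r\<^esub> Zp_of_int p (1 + k * x)"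

text \<open>The matrix entry at \<open>(a, b)\<close> depends only on the integer product
  \<open>a * b\<close>, so the matrix is handled as this function of one variable.\<close>

definition E :: "int \<Rightarrow> complex" where
  "E x = \<chi> (coset x)"

lemma Hmat_eq: "Hmat p r q \<chi> a b = E (a * b)"
  by (simp add: Hmat_def E_def coset_def mult.assoc)

lemma one_plus_mem_principal_units: "Zp_of_int p (1 + k * x) \<in> principal_units p r"
  by (simp add: principal_units_iff p_pos Zp_of_int_closed Zp_of_int_at mod_simps)

lemma carrier_principal_units_group: "carrier (principal_units_group p r) = principal_units p r"
  by (simp add: principal_units_group_def)

lemma coset_mem: "coset x \<in> carrier (principal_units_quotient p r q)"
  using one_plus_mem_principal_units[of x] carrier_principal_units_group
  unfolding principal_units_quotient_def coset_def by (auto simp: carrier_FactGroup)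

text \<open>\<open>(1 + k x) (1 + k y) = 1 + k (x + y + k x y)\<close>: in the coordinate
  \<open>x\<close> these units multiply by the multiplicative formal group law. The extra term
  \<open>k x y\<close> is the source of the denominators in the Moebius maps.\<close>

lemma coset_mult:
  "coset x \<otimes>\<^bsub>principal_units_quotient p r q\<^esub> coset y = coset (x + y + k * x * y)"
proof -
  interpret normal "principal_units p (q + r)" "principal_units_group p r"
    by (rule principal_units_normal[OF prime r]) simp
  have "coset x \<otimes>\<^bsub>principal_units_quotient p r q\<^esub> coset y =
    principal_units p (q + r) #>\<^bsub>principal_units_group p r\<^esub>
      (Zp_of_int p (1 + k * x) \<otimes>\<^bsub>principal_units_group p r\<^esub> Zp_of_int p (1 + k * y))"
    unfolding principal_units_quotient_def coset_def
    by (simp add: rcos_sum one_plus_mem_principal_units carrier_principal_units_group)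
  also have "Zp_of_int p (1 + k * x) \<otimes>\<^bsub>principal_units_group p r\<^esub> Zp_of_int p (1 + k * y)
    = Zp_of_int p (1 + k * (x + y + k * x * y))"
    by (simp add: principal_units_group_def units_of_mult flip: Zp_of_int_mult)
      (simp add: algebra_simps)
  finally show ?thesis by (simp add: coset_def)
qed

lemma coset_iff:
  "z \<in> coset x \<longleftrightarrow> z \<in> carrier (Zp p) \<and> z (q + r) = (1 + k * x) mod int p ^ (q + r)"
proof -
  let ?g = "Zp_of_int p (1 + k * x)" and ?G = "units_of (Zp p)"
  interpret cring "Zp p" by (rule Zp_cring[OF p_pos])
  interpret U: group ?G by (rule units_group)
  have g: "?g \<in> Units (Zp p)"
    using one_plus_mem_principal_units[of x] principal_units_subgroup[OF prime r, THEN subgroup.subset]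
    by (auto simp: units_of_carrier)
  have "z \<in> coset x \<longleftrightarrow> (\<exists>h \<in> principal_units p (q + r). z = h \<otimes>\<^bsub>Zp p\<^esub> ?g)"
    by (auto simp: coset_def r_coset_def principal_units_group_def units_of_mult)
  also have "\<dots> \<longleftrightarrow> z \<in> carrier (Zp p) \<and> z (q + r) = (1 + k * x) mod int p ^ (q + r)"
  proof (intro iffI; (elim conjE bexE)?)
    fix h assume "h \<in> principal_units p (q + r)" "z = h \<otimes>\<^bsub>Zp p\<^esub> ?g"
    then show "z \<in> carrier (Zp p) \<and> z (q + r) = (1 + k * x) mod int p ^ (q + r)"
      by (simp add: principal_units_iff p_pos Zp_of_int_closed Zp_mult Zp_of_int_at mod_simps)
  next
    assume z: "z \<in> carrier (Zp p)" and zx: "z (q + r) = (1 + k * x) mod int p ^ (q + r)"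
    have gi: "?g \<otimes>\<^bsub>Zp p\<^esub> inv\<^bsub>Zp p\<^esub> ?g = \<one>\<^bsub>Zp p\<^esub>"
      using g by simp
    have "(z \<otimes>\<^bsub>Zp p\<^esub> inv\<^bsub>Zp p\<^esub> ?g) (q + r) = (?g \<otimes>\<^bsub>Zp p\<^esub> inv\<^bsub>Zp p\<^esub> ?g) (q + r)"
      by (simp only: Zp_mult zx Zp_of_int_at)
    then have "z \<otimes>\<^bsub>Zp p\<^esub> inv\<^bsub>Zp p\<^esub> ?g \<in> principal_units p (q + r)"
      using z g by (simp add: principal_units_iff p_pos Zp_one)
    moreover have "z = (z \<otimes>\<^bsub>Zp p\<^esub> inv\<^bsub>Zp p\<^esub> ?g) \<otimes>\<^bsub>Zp p\<^esub> ?g"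
      using z g by (metis Units_closed Units_inv_closed Units_l_inv m_assoc r_one)
    ultimately show "\<exists>h \<in> principal_units p (q + r). z = h \<otimes>\<^bsub>Zp p\<^esub> ?g" by blast
  qed
  finally show ?thesis .
qed

text \<open>The two units are compared modulo \<open>p ^ (q + r)\<close>, and the factor
  \<open>k = p ^ r\<close> in front of \<open>x - y\<close> cancels; hence the modulus
  \<open>p ^ q\<close> for the indices.\<close>

lemma coset_eq_iff: "coset x = coset y \<longleftrightarrow> [x = y] (mod m)"
proof -
  have "coset x = coset y \<longleftrightarrow> (1 + k * x) mod int p ^ (q + r) = (1 + k * y) mod int p ^ (q + r)"
  proof
    assume "coset x = coset y"
    moreover have "Zp_of_int p (1 + k * x) \<in> coset x"
      by (simp add: coset_iff Zp_of_int_closed p_pos Zp_of_int_at)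
    ultimately show "(1 + k * x) mod int p ^ (q + r) = (1 + k * y) mod int p ^ (q + r)"
      by (simp add: coset_iff Zp_of_int_at)
  qed (auto simp: coset_iff)
  also have "\<dots> \<longleftrightarrow> k * m dvd k * (x - y)"
    by (simp add: mod_eq_dvd_iff power_add algebra_simps)
  also have "\<dots> \<longleftrightarrow> [x = y] (mod m)"
    using p_pos by (simp add: cong_iff_dvd_diff)
  finally show ?thesis .
qed

lemma E_mult: "E x * E y = E (x + y + k * x * y)"
proof -
  have "\<chi> (coset x \<otimes>\<^bsub>principal_units_quotient p r q\<^esub> coset y) = \<chi> (coset x) * \<chi> (coset y)"
    using faithful hom_mult[OF _ coset_mem coset_mem, of \<chi> circle_group]
    by (simp add: faithful_character_def circle_group_def)
  then show ?thesis by (simp add: E_def coset_mult)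
qed

lemma norm_E: "cmod (E x) = 1"
  using faithful hom_in_carrier[OF _ coset_mem, of \<chi> circle_group]
  by (simp add: E_def faithful_character_def circle_group_def)

lemma E_nonzero: "E x \<noteq> 0"
  using norm_E[of x] by auto

lemma E_0: "E 0 = 1"
  using E_mult[of 0 0] E_nonzero[of 0] by simp

lemma E_eq_iff: "E x = E y \<longleftrightarrow> [x = y] (mod m)"
proof -
  have "inj_on \<chi> (carrier (principal_units_quotient p r q))"
    using faithful by (simp add: faithful_character_def)
  then have "E x = E y \<longleftrightarrow> coset x = coset y"
    unfolding E_def by (rule inj_on_eq_iff) (rule coset_mem)+
  then show ?thesis by (simp only: coset_eq_iff)
qed

end

section \<open>The group of projective monomial automorphisms\<close>

lemma restrict_eqI: "f \<in> extensional A \<Longrightarrow> (\<And>x. x \<in> A \<Longrightarrow> g x = f x) \<Longrightarrow> restrict g A = f"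
  by (rule extensionalityI[of _ A]) auto

context character_matrix
begin

abbreviation "Q \<equiv> quad_group p r q \<chi>"
abbreviation "N \<equiv> scalar_quads p q"

definition scalar :: "complex \<Rightarrow> quad" where
  "scalar \<zeta> = (\<lambda>a\<in>S. a, \<lambda>b\<in>S. b, \<lambda>a\<in>S. \<zeta>, \<lambda>b\<in>S. \<zeta>)"

lemma scalar_quads_eq: "N = scalar ` {\<zeta>. cmod \<zeta> = 1}"
  by (auto simp: scalar_quads_def scalar_def Let_def)

lemma quad_carrier_iff:
  "(\<pi>, \<sigma>, \<alpha>, \<omega>) \<in> carrier Q \<longleftrightarrow> \<pi> \<in> Bij S \<and> \<sigma> \<in> Bij S \<and>
    \<alpha> \<in> S \<rightarrow>\<^sub>E {z. cmod z = 1} \<and> \<omega> \<in> S \<rightarrow>\<^sub>E {z. cmod z = 1} \<and>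
    (\<forall>a\<in>S. \<forall>b\<in>S. E (a * \<sigma> b) * \<omega> b = \<alpha> a * E (\<pi> a * b))"
  by (simp add: quad_group_def Let_def Hmat_eq)

lemma quad_mult:
  "(\<pi>, \<sigma>, \<alpha>, \<omega>) \<otimes>\<^bsub>Q\<^esub> (\<pi>', \<sigma>', \<alpha>', \<omega>') = (compose S \<pi> \<pi>', compose S \<sigma>' \<sigma>,
    \<lambda>a\<in>S. \<alpha>' a * \<alpha> (\<pi>' a), \<lambda>b\<in>S. \<omega> b * \<omega>' (\<sigma> b))"
  by (simp add: quad_group_def Let_def)

lemma quad_one: "\<one>\<^bsub>Q\<^esub> = scalar 1"
  by (simp add: quad_group_def Let_def scalar_def)

lemma Bij_mem: "f \<in> Bij S \<Longrightarrow> x \<in> S \<Longrightarrow> f x \<in> S"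
  using Bij_imp_funcset by fastforce

lemma scalar_in_carrier: "cmod \<zeta> = 1 \<Longrightarrow> scalar \<zeta> \<in> carrier Q"
  by (auto simp: scalar_def quad_carrier_iff id_Bij)

lemma quad_mult_closed:
  assumes "x \<in> carrier Q" "y \<in> carrier Q"
  shows "x \<otimes>\<^bsub>Q\<^esub> y \<in> carrier Q"
proof -
  obtain \<pi> \<sigma> \<alpha> \<omega> where x: "x = (\<pi>, \<sigma>, \<alpha>, \<omega>)" by (cases x)
  obtain \<pi>' \<sigma>' \<alpha>' \<omega>' where y: "y = (\<pi>', \<sigma>', \<alpha>', \<omega>')" by (cases y)
  have x': "\<pi> \<in> Bij S" "\<sigma> \<in> Bij S" "\<alpha> \<in> S \<rightarrow>\<^sub>E {z. cmod z = 1}" "\<omega> \<in> S \<rightarrow>\<^sub>E {z. cmod z = 1}"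
    and xr: "\<And>a b. a \<in> S \<Longrightarrow> b \<in> S \<Longrightarrow> E (a * \<sigma> b) * \<omega> b = \<alpha> a * E (\<pi> a * b)"
    using assms(1) unfolding x quad_carrier_iff by auto
  have y': "\<pi>' \<in> Bij S" "\<sigma>' \<in> Bij S" "\<alpha>' \<in> S \<rightarrow>\<^sub>E {z. cmod z = 1}" "\<omega>' \<in> S \<rightarrow>\<^sub>E {z. cmod z = 1}"
    and yr: "\<And>a b. a \<in> S \<Longrightarrow> b \<in> S \<Longrightarrow> E (a * \<sigma>' b) * \<omega>' b = \<alpha>' a * E (\<pi>' a * b)"
    using assms(2) unfolding y quad_carrier_iff by auto
  have m: "\<pi>' a \<in> S" "\<sigma> a \<in> S" if "a \<in> S" for a
    using that x' y' by (simp_all add: Bij_mem)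
  have "E (a * \<sigma>' (\<sigma> b)) * (\<omega> b * \<omega>' (\<sigma> b)) = \<alpha>' a * \<alpha> (\<pi>' a) * E (\<pi> (\<pi>' a) * b)"
    if ab: "a \<in> S" "b \<in> S" for a b
  proof -
    \<comment> \<open>The relation of \<open>y\<close> is applied at \<open>(a, \<sigma> b)\<close>
      and then that of \<open>x\<close> at \<open>(\<pi>' a, b)\<close>; this order is what makes
      the column permutations compose in reverse.\<close>
    have "E (a * \<sigma>' (\<sigma> b)) * (\<omega> b * \<omega>' (\<sigma> b)) = (E (a * \<sigma>' (\<sigma> b)) * \<omega>' (\<sigma> b)) * \<omega> b"
      by simp
    also have "\<dots> = \<alpha>' a * (E (\<pi>' a * \<sigma> b) * \<omega> b)"
      using ab by (simp add: yr m)
    also have "\<dots> = \<alpha>' a * \<alpha> (\<pi>' a) * E (\<pi> (\<pi>' a) * b)"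
      using ab by (simp add: xr m)
    finally show ?thesis .
  qed
  moreover have "cmod (\<alpha>' a * \<alpha> (\<pi>' a)) = 1" "cmod (\<omega> a * \<omega>' (\<sigma> a)) = 1" if "a \<in> S" for a
    using that x'(3,4) y'(3,4) m[OF that] by (auto simp: norm_mult PiE_iff)
  ultimately show ?thesis
    using x'(1,2) y'(1,2) unfolding x y quad_mult quad_carrier_iff
    by (auto simp: compose_Bij compose_eq)
qed

lemma quad_group_is_group: "group Q"
proof (rule groupI)
  fix x y z assume xyz: "x \<in> carrier Q" "y \<in> carrier Q" "z \<in> carrier Q"
  obtain \<pi> \<sigma> \<alpha> \<omega> where x: "x = (\<pi>, \<sigma>, \<alpha>, \<omega>)" by (cases x)
  obtain \<pi>' \<sigma>' \<alpha>' \<omega>' where y: "y = (\<pi>', \<sigma>', \<alpha>', \<omega>')" by (cases y)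
  obtain \<pi>'' \<sigma>'' \<alpha>'' \<omega>'' where z: "z = (\<pi>'', \<sigma>'', \<alpha>'', \<omega>'')" by (cases z)
  have B: "\<pi>'' \<in> Bij S" "\<pi>' \<in> Bij S" "\<sigma> \<in> Bij S" "\<sigma>' \<in> Bij S"
    using xyz unfolding x y z quad_carrier_iff by auto
  show "x \<otimes>\<^bsub>Q\<^esub> y \<otimes>\<^bsub>Q\<^esub> z = x \<otimes>\<^bsub>Q\<^esub> (y \<otimes>\<^bsub>Q\<^esub> z)"
    unfolding x y z quad_mult prod.inject
    by (intro conjI compose_assoc[symmetric] compose_assoc restrict_ext)
      (simp_all add: B Bij_imp_funcset Bij_mem compose_eq mult.assoc)
next
  fix x assume xc: "x \<in> carrier Q"
  obtain \<pi> \<sigma> \<alpha> \<omega> where x: "x = (\<pi>, \<sigma>, \<alpha>, \<omega>)" by (cases x)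
  have B: "\<pi> \<in> Bij S" "\<sigma> \<in> Bij S" and \<alpha>: "\<alpha> \<in> S \<rightarrow>\<^sub>E {z. cmod z = 1}"
    and \<omega>: "\<omega> \<in> S \<rightarrow>\<^sub>E {z. cmod z = 1}"
    and rel: "\<And>a b. a \<in> S \<Longrightarrow> b \<in> S \<Longrightarrow> E (a * \<sigma> b) * \<omega> b = \<alpha> a * E (\<pi> a * b)"
    using xc unfolding x quad_carrier_iff by auto
  have ext: "\<pi> \<in> extensional S" "\<sigma> \<in> extensional S" "\<alpha> \<in> extensional S" "\<omega> \<in> extensional S"
    using B \<alpha> \<omega> by (auto simp: Bij_imp_extensional PiE_iff)
  show "\<one>\<^bsub>Q\<^esub> \<otimes>\<^bsub>Q\<^esub> x = x"
    unfolding quad_one scalar_def x quad_mult prod.inject compose_def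
    by (intro conjI restrict_eqI ext) (simp_all add: B Bij_mem)
  define \<pi>i \<sigma>i where "\<pi>i = (\<lambda>a\<in>S. inv_into S \<pi> a)" and "\<sigma>i = (\<lambda>b\<in>S. inv_into S \<sigma> b)"
  define y :: quad where "y = (\<pi>i, \<sigma>i, \<lambda>a\<in>S. inverse (\<alpha> (\<pi>i a)), \<lambda>b\<in>S. inverse (\<omega> (\<sigma>i b)))"
  have Bi: "\<pi>i \<in> Bij S" "\<sigma>i \<in> Bij S"
    using B by (simp_all add: \<pi>i_def \<sigma>i_def restrict_inv_into_Bij)
  have bij: "bij_betw \<pi> S S" "bij_betw \<sigma> S S"
    using B by (simp_all add: Bij_def)
  have cancel: "\<pi> (\<pi>i a) = a" "\<sigma> (\<sigma>i a) = a" "\<pi>i (\<pi> a) = a" "\<sigma>i (\<sigma> a) = a" if "a \<in> S" for a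
    using that bij B unfolding \<pi>i_def \<sigma>i_def
    by (simp_all add: bij_betw_inv_into_right bij_betw_inv_into_left Bij_mem)
  have nz: "\<alpha> a \<noteq> 0" "\<omega> a \<noteq> 0" if "a \<in> S" for a
    using that \<alpha> \<omega> by (auto simp: PiE_iff)
  \<comment> \<open>This is the relation for \<open>x\<close> at
    \<open>(\<pi>i a, \<sigma>i b)\<close>, with both scalars moved to the opposite sides.\<close>
  have "E (a * \<sigma>i b) * inverse (\<omega> (\<sigma>i b)) = inverse (\<alpha> (\<pi>i a)) * E (\<pi>i a * b)"
    if ab: "a \<in> S" "b \<in> S" for a b
    using rel[of "\<pi>i a" "\<sigma>i b"] nz[of "\<pi>i a"] nz[of "\<sigma>i b"] ab Bi
    by (simp add: cancel Bij_mem field_simps)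
  then have "y \<in> carrier Q"
    using Bi \<alpha> \<omega> unfolding y_def quad_carrier_iff
    by (auto simp: PiE_iff norm_inverse Bij_mem)
  moreover have "y \<otimes>\<^bsub>Q\<^esub> x = \<one>\<^bsub>Q\<^esub>"
    unfolding quad_one scalar_def x y_def quad_mult prod.inject compose_def
    by (intro conjI restrict_ext) (simp_all add: B Bi Bij_mem cancel nz)
  ultimately show "\<exists>y\<in>carrier Q. y \<otimes>\<^bsub>Q\<^esub> x = \<one>\<^bsub>Q\<^esub>" by blast
qed (simp_all add: quad_mult_closed quad_one scalar_in_carrier)

text \<open>The two products coincide, so the scalar quadruples are central; their normality rests
  on this.\<close>

lemma scalar_mult:
  assumes "(\<pi>, \<sigma>, \<alpha>, \<omega>) \<in> carrier Q"
  shows "scalar \<zeta> \<otimes>\<^bsub>Q\<^esub> (\<pi>, \<sigma>, \<alpha>, \<omega>) = (\<pi>, \<sigma>, \<lambda>a\<in>S. \<zeta> * \<alpha> a, \<lambda>b\<in>S. \<zeta> * \<omega> b)"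
    and "(\<pi>, \<sigma>, \<alpha>, \<omega>) \<otimes>\<^bsub>Q\<^esub> scalar \<zeta> = (\<pi>, \<sigma>, \<lambda>a\<in>S. \<zeta> * \<alpha> a, \<lambda>b\<in>S. \<zeta> * \<omega> b)"
proof -
  have B: "\<pi> \<in> Bij S" "\<sigma> \<in> Bij S"
    using assms unfolding quad_carrier_iff by auto
  then have "\<pi> \<in> extensional S" "\<sigma> \<in> extensional S"
    by (simp_all add: Bij_imp_extensional)
  note ext = this
  show "scalar \<zeta> \<otimes>\<^bsub>Q\<^esub> (\<pi>, \<sigma>, \<alpha>, \<omega>) = (\<pi>, \<sigma>, \<lambda>a\<in>S. \<zeta> * \<alpha> a, \<lambda>b\<in>S. \<zeta> * \<omega> b)"
    "(\<pi>, \<sigma>, \<alpha>, \<omega>) \<otimes>\<^bsub>Q\<^esub> scalar \<zeta> = (\<pi>, \<sigma>, \<lambda>a\<in>S. \<zeta> * \<alpha> a, \<lambda>b\<in>S. \<zeta> * \<omega> b)"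
    unfolding scalar_def quad_mult prod.inject compose_def
    by (intro conjI restrict_eqI restrict_ext ext; simp add: B Bij_mem)+
qed

lemma scalar_mult_scalar: "cmod \<eta> = 1 \<Longrightarrow> scalar \<zeta> \<otimes>\<^bsub>Q\<^esub> scalar \<eta> = scalar (\<zeta> * \<eta>)"
  using scalar_mult(1)[OF scalar_in_carrier[of \<eta>, unfolded scalar_def], folded scalar_def]
  by (auto simp: scalar_def fun_eq_iff)

lemma scalar_quads_normal: "N \<lhd> Q"
proof -
  interpret Q: group Q by (rule quad_group_is_group)
  have sub: "N \<subseteq> carrier Q"
    by (auto simp: scalar_quads_eq scalar_in_carrier)
  have "subgroup N Q"
  proof (rule Q.subgroupI[OF sub])
    show "N \<noteq> {}"
      by (auto simp: scalar_quads_eq intro!: exI[of _ 1])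
  next
    fix x assume "x \<in> N"
    then obtain \<zeta> where \<zeta>: "cmod \<zeta> = 1" "x = scalar \<zeta>" by (auto simp: scalar_quads_eq)
    moreover have "\<zeta> \<noteq> 0" using \<zeta> by auto
    ultimately have "scalar (inverse \<zeta>) \<otimes>\<^bsub>Q\<^esub> x = \<one>\<^bsub>Q\<^esub>"
      by (subst \<zeta>(2), subst scalar_mult_scalar) (auto simp: quad_one intro!: arg_cong[of _ _ scalar])
    then have "inv\<^bsub>Q\<^esub> x = scalar (inverse \<zeta>)"
      using \<zeta> by (intro Q.inv_equality) (auto simp: scalar_in_carrier norm_inverse)
    then show "inv\<^bsub>Q\<^esub> x \<in> N"
      using \<zeta> by (auto simp: scalar_quads_eq norm_inverse)
  next
    fix x y assume "x \<in> N" "y \<in> N"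
    then show "x \<otimes>\<^bsub>Q\<^esub> y \<in> N"
      by (auto simp: scalar_quads_eq scalar_mult_scalar norm_mult)
  qed
  moreover have "x \<otimes>\<^bsub>Q\<^esub> h \<otimes>\<^bsub>Q\<^esub> inv\<^bsub>Q\<^esub> x \<in> N" if x: "x \<in> carrier Q" and h: "h \<in> N" for x h
  proof -
    have "x \<otimes>\<^bsub>Q\<^esub> h = h \<otimes>\<^bsub>Q\<^esub> x"
      using x h by (cases x) (auto simp: scalar_quads_eq scalar_mult)
    then have "x \<otimes>\<^bsub>Q\<^esub> h \<otimes>\<^bsub>Q\<^esub> inv\<^bsub>Q\<^esub> x = h"
      using x h sub by (simp add: Q.m_assoc subsetD)
    then show ?thesis using h by simp
  qed
  ultimately show ?thesis
    by (simp add: Q.normal_inv_iff)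
qed

lemma triple_quad_eq:
  "triple_quad p r q \<chi> (c, s, l) = (\<lambda>a\<in>S. moebius p r q c l s a, \<lambda>b\<in>S. moebius p r q s l c b,
    \<lambda>a\<in>S. E (a * s), \<lambda>b\<in>S. E (c * b))"
  unfolding triple_quad.simps Let_def prod.inject
  by (intro conjI restrict_ext) (simp_all add: Hmat_eq)

text \<open>By \<open>E_mult\<close> the left-hand product has argument
  \<open>a * y * (1 + k * (c * b)) + c * b\<close>, with \<open>y\<close> the column image of
  \<open>b\<close>, and the factor in brackets clears the denominator of \<open>y\<close>. The
  right-hand side simplifies in the same way, and both arguments become
  \<open>a * s + c * b + l * a * b\<close> modulo \<open>m\<close>.\<close>

lemma triple_quad_in_carrier:
  assumes "t \<in> triples p q"
  shows "triple_quad p r q \<chi> t \<in> carrier Q"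
proof -
  obtain c s l where t: "t = (c, s, l)" by (metis prod_cases3)
  have l: "\<not> int p dvd l" using assms by (simp add: t triples_iff)
  have "E (a * moebius p r q s l c b) * E (c * b) = E (a * s) * E (moebius p r q c l s a * b)" for a b
  proof -
    let ?y = "moebius p r q s l c b" and ?z = "moebius p r q c l s a"
    have "a * ?y + c * b + k * (a * ?y) * (c * b) = a * ((1 + k * (c * b)) * ?y) + c * b"
      by (simp add: algebra_simps)
    also have "[a * ((1 + k * (c * b)) * ?y) + c * b = a * (s + l * b) + c * b] (mod m)"
      by (intro cong_add cong_scalar_left moebius_cong cong_refl)
    also have "a * (s + l * b) + c * b = a * s + b * (c + l * a)"
      by (simp add: algebra_simps)
    also have "[a * s + b * (c + l * a) = a * s + b * ((1 + k * (s * a)) * ?z)] (mod m)"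
      by (intro cong_add cong_scalar_left cong_sym[OF moebius_cong] cong_refl)
    also have "a * s + b * ((1 + k * (s * a)) * ?z) = a * s + ?z * b + k * (a * s) * (?z * b)"
      by (simp add: algebra_simps)
    finally show ?thesis
      by (simp only: E_mult E_eq_iff)
  qed
  then show ?thesis
    unfolding t triple_quad_eq quad_carrier_iff
    using moebius_Bij[OF l] by (auto simp: norm_E)
qed

text \<open>Setting \<open>a = 0\<close> and \<open>b = 0\<close> in the defining equation determines \<open>\<omega>\<close> and \<open>\<alpha>\<close> up to a common
  scalar; faithfulness of the character turns the equation into a congruence, and setting
  \<open>b = 1\<close> and \<open>a = 1\<close> in it shows that \<open>\<pi>\<close> and \<open>\<sigma>\<close> are Moebius maps. If \<open>p\<close> divided \<open>l\<close>, then \<open>\<pi>\<close>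
  would identify \<open>p ^ (q - 1)\<close> with \<open>0\<close>.\<close>

lemma quad_classification:
  assumes x: "x \<in> carrier Q"
  obtains t \<zeta> where "t \<in> triples p q" "cmod \<zeta> = 1" "x = scalar \<zeta> \<otimes>\<^bsub>Q\<^esub> triple_quad p r q \<chi> t"
proof -
  obtain \<pi> \<sigma> \<alpha> \<omega> where x_eq: "x = (\<pi>, \<sigma>, \<alpha>, \<omega>)" by (cases x)
  have B: "\<pi> \<in> Bij S" "\<sigma> \<in> Bij S" and \<alpha>: "\<alpha> \<in> S \<rightarrow>\<^sub>E {z. cmod z = 1}"
    and \<omega>: "\<omega> \<in> S \<rightarrow>\<^sub>E {z. cmod z = 1}"
    and rel: "\<And>a b. a \<in> S \<Longrightarrow> b \<in> S \<Longrightarrow> E (a * \<sigma> b) * \<omega> b = \<alpha> a * E (\<pi> a * b)"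
    using x unfolding x_eq quad_carrier_iff by auto
  have S01: "0 \<in> S" "1 \<in> S"
    using m_gt_1 m_pos by (simp_all add: S_eq)
  define \<zeta> c s where "\<zeta> = \<omega> 0" and "c = \<pi> 0" and "s = \<sigma> 0"
  \<comment> \<open>Obtained by solving \<open>(1 + k * s) * \<pi> 1 = c + l\<close>, the expected
    Moebius formula at 1, for \<open>l\<close>.\<close>
  define l where "l = (\<pi> 1 * (1 + k * s) - c) mod m"
  have cs: "c \<in> S" "s \<in> S"
    using B S01 by (simp_all add: c_def s_def Bij_mem)
  have \<zeta>1: "cmod \<zeta> = 1" using \<omega> S01 by (auto simp: \<zeta>_def PiE_iff)
  then have \<zeta>0: "\<zeta> \<noteq> 0" by auto
  have \<alpha>0: "\<alpha> 0 = \<zeta>"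
    using rel[of 0 0] S01 by (simp add: E_0 \<zeta>_def)
  have \<omega>_eq: "\<omega> b = \<zeta> * E (c * b)" if "b \<in> S" for b
    using rel[of 0 b] S01 that by (simp add: E_0 \<alpha>0 c_def)
  have \<alpha>_eq: "\<alpha> a = \<zeta> * E (a * s)" if "a \<in> S" for a
    using rel[of a 0] S01 that by (simp add: E_0 \<zeta>_def s_def mult.commute)
  have key: "[a * \<sigma> b + c * b + k * (a * \<sigma> b) * (c * b) = a * s + \<pi> a * b + k * (a * s) * (\<pi> a * b)] (mod m)"
    if "a \<in> S" "b \<in> S" for a b
  proof -
    have "\<zeta> * (E (a * \<sigma> b) * E (c * b)) = \<zeta> * (E (a * s) * E (\<pi> a * b))"
      using rel[OF that] that by (simp add: \<omega>_eq \<alpha>_eq mult_ac)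
    then show ?thesis
      using \<zeta>0 by (simp add: E_mult E_eq_iff)
  qed
  have l: "[l = \<pi> 1 * (1 + k * s) - c] (mod m)"
    by (simp add: l_def cong_def)
  have key_row: "[(1 + k * (s * a)) * \<pi> a = c + (\<sigma> 1 * (1 + k * c) - s) * a] (mod m)" if "a \<in> S" for a
    using key[OF that S01(2)] by (simp add: cong_iff_dvd_diff algebra_simps dvd_diff_commute)
  \<comment> \<open>The column permutation yields its own candidate for \<open>l\<close>; the
    instance \<open>a = b = 1\<close> shows that it agrees with the one from the row
    permutation.\<close>
  have "[\<sigma> 1 * (1 + k * c) - s = \<pi> 1 * (1 + k * s) - c] (mod m)"
    using key_row[OF S01(2)] by (simp add: cong_iff_dvd_diff algebra_simps dvd_diff_commute)
  then have l': "[\<sigma> 1 * (1 + k * c) - s = l] (mod m)"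
    using cong_sym[OF l] by (rule cong_trans)
  have row: "[(1 + k * (s * a)) * \<pi> a = c + l * a] (mod m)" if "a \<in> S" for a
    using key_row[OF that] cong_add[OF cong_refl cong_scalar_right[OF l']] by (rule cong_trans)
  have "[(1 + k * (c * b)) * \<sigma> b = s + (\<pi> 1 * (1 + k * s) - c) * b] (mod m)" if "b \<in> S" for b
    using key[OF S01(2) that] by (simp add: cong_iff_dvd_diff algebra_simps)
  then have col: "[(1 + k * (c * b)) * \<sigma> b = s + l * b] (mod m)" if "b \<in> S" for b
    using that cong_add[OF cong_refl cong_scalar_right[OF cong_sym[OF l]]] by (blast intro: cong_trans)
  have \<pi>_eq: "moebius p r q c l s a = \<pi> a" if "a \<in> S" for a
    using that B by (intro moebius_eqI row) (simp_all add: Bij_mem)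
  have \<sigma>_eq: "moebius p r q s l c b = \<sigma> b" if "b \<in> S" for b
    using that B by (intro moebius_eqI col) (simp_all add: Bij_mem)
  have "\<not> int p dvd l"
  proof
    let ?a = "int p ^ (q - 1)"
    assume "int p dvd l"
    have m_eq: "m = int p * ?a"
      using q by (simp flip: power_Suc)
    have a: "?a \<in> S" "?a \<noteq> 0"
      using p_gt_1 q by (auto simp: S_eq)
    \<comment> \<open>Both \<open>l\<close> and \<open>k\<close> are divisible by \<open>p\<close>,
      so at \<open>?a\<close> the numerator and denominator of the Moebius map reduce to
      \<open>c\<close> and 1 modulo \<open>m\<close>.\<close>
    have la: "m dvd l * ?a" and ka: "m dvd k * ?a"
      using \<open>int p dvd l\<close> p_dvd_k by (simp_all only: m_eq mult_dvd_mono dvd_refl)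
    have "(1 + k * (s * ?a)) * c - (c + l * ?a) = s * c * (k * ?a) - l * ?a"
      by (simp add: algebra_simps)
    also have "m dvd \<dots>"
      by (rule dvd_diff[OF dvd_mult[OF ka] la])
    finally have "moebius p r q c l s ?a = c"
      by (intro moebius_eqI cs) (simp only: cong_iff_dvd_diff)
    then have "\<pi> ?a = \<pi> 0"
      by (simp only: \<pi>_eq[OF a(1)] c_def[symmetric])
    moreover have "inj_on \<pi> S"
      using B(1) by (simp add: Bij_def bij_betw_def)
    ultimately show False
      using a S01(1) by (simp only: inj_on_eq_iff)
  qed
  moreover have "0 \<le> l" "l < m"
    using m_pos by (simp_all add: l_def)
  ultimately have t: "(c, s, l) \<in> triples p q"
    using cs by (simp add: triples_iff S_eq)
  have ext: "\<pi> \<in> extensional S" "\<sigma> \<in> extensional S" "\<alpha> \<in> extensional S" "\<omega> \<in> extensional S"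
    using B \<alpha> \<omega> by (auto simp: Bij_imp_extensional PiE_iff)
  have "scalar \<zeta> \<otimes>\<^bsub>Q\<^esub> triple_quad p r q \<chi> (c, s, l) = x"
    unfolding triple_quad_eq x_eq
      scalar_mult(1)[OF triple_quad_in_carrier[OF t, unfolded triple_quad_eq]] prod.inject
    by (intro conjI restrict_eqI ext) (simp_all add: \<pi>_eq \<sigma>_eq \<alpha>_eq \<omega>_eq)
  with t \<zeta>1 show ?thesis by (intro that) auto
qed

end

section \<open>Triples as coordinates on the projective classes, and their group law\<close>

context prime_power
begin

text \<open>The component \<open>l\<close> is recovered last: once \<open>c\<close> and
  \<open>s\<close> agree, the row values at 1 have the same denominator \<open>1 + k * s\<close>, so
  equal values give equal numerators.\<close>

lemma triple_eqI:
  assumes t: "t \<in> triples p q" "t' \<in> triples p q"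
    and row: "row_map p r q t 0 = row_map p r q t' 0" "row_map p r q t 1 = row_map p r q t' 1"
    and col: "col_map p r q t 0 = col_map p r q t' 0"
  shows "t = t'"
proof -
  obtain c s l c' s' l' where eq: "t = (c, s, l)" "t' = (c', s', l')"
    by (metis prod_cases3)
  have mem: "c \<in> S" "s \<in> S" "l \<in> S" "c' \<in> S" "s' \<in> S" "l' \<in> S"
    using t by (simp_all add: eq triples_iff S_eq)
  have cs: "c' = c" "s' = s"
    using row(1) col mem by (simp_all add: eq moebius_0)
  have "[c + l * 1 = (1 + k * (s * 1)) * moebius p r q c l s 1] (mod m)"
    by (rule cong_sym[OF moebius_cong])
  also have "moebius p r q c l s 1 = moebius p r q c l' s 1"
    using row(2) by (simp add: eq cs)
  also have "[(1 + k * (s * 1)) * moebius p r q c l' s 1 = c + l' * 1] (mod m)"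
    by (rule moebius_cong)
  finally have "[l = l'] (mod m)" by (simp add: cong_add_lcancel)
  then have "l = l'" using mem by (intro mem_eqI)
  then show ?thesis by (simp add: eq cs)
qed

text \<open>\<open>triple_eqI\<close> looks at the column map only at 0, where its value is the
  component \<open>s\<close>. Hence the composition law for columns is proved at this one point,
  with the factors in reverse order.\<close>

lemma triple_prod_col_0:
  assumes "t'' \<in> triples p q" "s \<in> S" "triple_prod m k (c, s, l) t' t''"
  shows "col_map p r q t'' 0 = col_map p r q t' (col_map p r q (c, s, l) 0)"
proof -
  obtain c' s' l' c'' s'' l'' where t: "t' = (c', s', l')" "t'' = (c'', s'', l'')"
    by (metis prod_cases3)
  have "s'' \<in> S" using assms(1) by (simp add: t triples_iff S_eq)
  moreover have "[(1 + k * (c' * s)) * s'' = s' + l' * s] (mod m)"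
    using assms(3) by (simp add: t ac_simps)
  ultimately show ?thesis
    using assms(2) by (simp add: t moebius_0 moebius_eqI)
qed

end

context character_matrix
begin

abbreviation "P \<equiv> proj_mon_aut p r q \<chi>"
abbreviation "class \<equiv> triple_class p r q \<chi>"

lemma proj_mon_aut_group: "group P"
  unfolding proj_mon_aut_def by (rule normal.factorgroup_is_group[OF scalar_quads_normal])

lemma scalar_rcoset:
  assumes "cmod \<zeta> = 1" "x \<in> carrier Q"
  shows "N #>\<^bsub>Q\<^esub> (scalar \<zeta> \<otimes>\<^bsub>Q\<^esub> x) = N #>\<^bsub>Q\<^esub> x"
proof -
  interpret normal N Q by (rule scalar_quads_normal)
  have "scalar \<zeta> \<in> N" using assms by (auto simp: scalar_quads_eq)
  then show ?thesis
    using assms by (metis coset_mult_assoc coset_join2 mem_carrier subgroup_axioms subset)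
qed

text \<open>Multiplying by a scalar quadruple changes neither permutation, so a class determines
  both.\<close>

lemma class_row_col:
  assumes "t \<in> triples p q" "(\<pi>, \<sigma>, \<alpha>, \<omega>) \<in> carrier Q"
    and "N #>\<^bsub>Q\<^esub> (\<pi>, \<sigma>, \<alpha>, \<omega>) = class t"
  shows "\<And>a. a \<in> S \<Longrightarrow> \<pi> a = row_map p r q t a" "\<And>b. b \<in> S \<Longrightarrow> \<sigma> b = col_map p r q t b"
proof -
  interpret normal N Q by (rule scalar_quads_normal)
  obtain c s l where t: "t = (c, s, l)" by (metis prod_cases3)
  note tq = triple_quad_in_carrier[OF assms(1)]
  have "(\<pi>, \<sigma>, \<alpha>, \<omega>) \<in> class t"
    unfolding assms(3)[symmetric] by (rule rcos_self[OF assms(2) subgroup_axioms])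
  then obtain \<zeta> where "(\<pi>, \<sigma>, \<alpha>, \<omega>) = scalar \<zeta> \<otimes>\<^bsub>Q\<^esub> triple_quad p r q \<chi> t"
    unfolding triple_class_def r_coset_def scalar_quads_eq by blast
  then show "\<And>a. a \<in> S \<Longrightarrow> \<pi> a = row_map p r q t a" "\<And>b. b \<in> S \<Longrightarrow> \<sigma> b = col_map p r q t b"
    using tq unfolding t triple_quad_eq by (simp_all add: scalar_mult)
qed

lemma zero_mem: "0 \<in> S" and one_in_S: "1 \<in> S"
  using m_gt_1 m_pos by (simp_all add: S_eq)

lemma triple_class_inj:
  assumes t: "t \<in> triples p q" "t' \<in> triples p q" and eq: "class t = class t'"
  shows "t = t'"
proof -
  obtain \<pi> \<sigma> \<alpha> \<omega> where tq: "triple_quad p r q \<chi> t = (\<pi>, \<sigma>, \<alpha>, \<omega>)" by (metis prod_cases4)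
  have c: "(\<pi>, \<sigma>, \<alpha>, \<omega>) \<in> carrier Q"
    using triple_quad_in_carrier[OF t(1)] tq by simp
  have e: "N #>\<^bsub>Q\<^esub> (\<pi>, \<sigma>, \<alpha>, \<omega>) = class t"
    by (simp add: triple_class_def tq)
  note 1 = class_row_col[OF t(1) c e] and 2 = class_row_col[OF t(2) c e[unfolded eq]]
  show ?thesis
    using 1 2 zero_mem one_in_S by (intro triple_eqI t) metis+
qed

lemma carrier_proj_mon_aut: "carrier P = class ` triples p q"
proof -
  have "N #>\<^bsub>Q\<^esub> x \<in> class ` triples p q" if "x \<in> carrier Q" for x
    using that
  proof (rule quad_classification)
    fix t \<zeta> assume t: "t \<in> triples p q" "cmod \<zeta> = 1" "x = scalar \<zeta> \<otimes>\<^bsub>Q\<^esub> triple_quad p r q \<chi> t"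
    then have "N #>\<^bsub>Q\<^esub> x = class t"
      by (simp add: scalar_rcoset triple_quad_in_carrier triple_class_def)
    then show ?thesis using t by blast
  qed
  moreover have "class t \<in> (\<lambda>x. N #>\<^bsub>Q\<^esub> x) ` carrier Q" if "t \<in> triples p q" for t
    unfolding triple_class_def using that by (intro imageI triple_quad_in_carrier)
  ultimately show ?thesis
    unfolding proj_mon_aut_def carrier_FactGroup by (intro equalityI image_subsetI)
qed

lemma class_mult:
  assumes t: "t \<in> triples p q" "t' \<in> triples p q" "t'' \<in> triples p q"
    and prod: "triple_prod m k t t' t''"
  shows "class t \<otimes>\<^bsub>P\<^esub> class t' = class t''"
proof -
  interpret normal N Q by (rule scalar_quads_normal)
  obtain c s l where t_eq: "t = (c, s, l)" by (metis prod_cases3)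
  obtain c' s' l' where t'_eq: "t' = (c', s', l')" by (metis prod_cases3)
  let ?x = "triple_quad p r q \<chi> t \<otimes>\<^bsub>Q\<^esub> triple_quad p r q \<chi> t'"
  note tq = triple_quad_in_carrier[OF t(1)] triple_quad_in_carrier[OF t(2)]
  have P_eq: "class t \<otimes>\<^bsub>P\<^esub> class t' = N #>\<^bsub>Q\<^esub> ?x"
    using tq by (simp add: proj_mon_aut_def triple_class_def rcos_sum)
  have xc: "?x \<in> carrier Q" using tq by simp
  then have "N #>\<^bsub>Q\<^esub> ?x \<in> carrier P"
    unfolding proj_mon_aut_def carrier_FactGroup by simp
  \<comment> \<open>The classification provides some triple \<open>u\<close> for the product class;
    what remains is \<open>u = t''\<close>, which only compares permutations.\<close>
  then obtain u where u: "u \<in> triples p q" "N #>\<^bsub>Q\<^esub> ?x = class u"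
    unfolding carrier_proj_mon_aut by blast
  obtain \<pi> \<sigma> \<alpha> \<omega> where x: "?x = (\<pi>, \<sigma>, \<alpha>, \<omega>)" by (metis prod_cases4)
  note rc = class_row_col[OF u(1) xc[unfolded x] u(2)[unfolded x]]
  have "\<pi> a = row_map p r q t (row_map p r q t' a)" "\<sigma> a = col_map p r q t' (col_map p r q t a)"
    if "a \<in> S" for a
    using x that moebius_mem unfolding t_eq t'_eq triple_quad_eq quad_mult
    by (auto simp: compose_eq)
  moreover have "s \<in> S" using t by (simp add: t_eq triples_iff S_eq)
  ultimately have "u = t''"
    using rc zero_mem one_in_S triple_prod_row[OF prod]
      triple_prod_col_0[OF t(3) _ prod[unfolded t_eq], folded t_eq]
    by (intro triple_eqI u t) metis+
  then show ?thesis using P_eq u by simp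
qed

end

section \<open>Reduction of triples and the transition maps\<close>

context prime_power
begin

text \<open>The congruence that characterises the Moebius value holds modulo the smaller power as
  well, and there it has only one solution among the residues.\<close>

lemma moebius_mod:
  assumes "1 \<le> q'" "q' \<le> q"
  shows "moebius p r q u l v x mod int p ^ q' =
    moebius p r q' (u mod int p ^ q') (l mod int p ^ q') (v mod int p ^ q') (x mod int p ^ q')"
proof -
  interpret q': prime_power p r q' using assms prime r by unfold_locales
  let ?m' = "int p ^ q'"
  have "[(1 + k * (v * x)) * moebius p r q u l v x = u + l * x] (mod ?m')"
    using moebius_cong by (rule cong_dvd_modulus) (simp add: assms le_imp_power_dvd)
  moreover have "[(1 + k * ((v mod ?m') * (x mod ?m'))) * (moebius p r q u l v x mod ?m')
     = (1 + k * (v * x)) * moebius p r q u l v x] (mod ?m')"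
    by (intro cong_mult cong_add cong_refl) (simp_all add: cong_def)
  moreover have "[u + l * x = (u mod ?m') + (l mod ?m') * (x mod ?m')] (mod ?m')"
    by (intro cong_mult cong_add) (simp_all add: cong_def)
  ultimately have "[(1 + k * ((v mod ?m') * (x mod ?m'))) * (moebius p r q u l v x mod ?m')
     = (u mod ?m') + (l mod ?m') * (x mod ?m')] (mod ?m')"
    by (blast intro: cong_trans)
  then show ?thesis
    by (intro q'.moebius_eqI[symmetric]) (use q'.m_pos in \<open>auto simp: q'.S_eq\<close>)
qed

lemma reduce_triple_mem:
  assumes "1 \<le> q'" "q' \<le> q" "t \<in> triples p q"
  shows "reduce_triple p q' t \<in> triples p q'"
proof -
  interpret q': prime_power p r q' using assms prime r by unfold_locales
  obtain c s l where t: "t = (c, s, l)" by (metis prod_cases3)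
  have "int p dvd l mod int p ^ q' \<longleftrightarrow> int p dvd l"
    using assms by (intro dvd_mod_iff) simp
  then show ?thesis
    using assms(3) pos_mod_sign[OF q'.m_pos] pos_mod_bound[OF q'.m_pos]
    by (simp add: t q'.triples_iff triples_iff)
qed

lemma reduce_triple_prod:
  assumes "q' \<le> q" "triple_prod m k t t' t''"
  shows "triple_prod (int p ^ q') k (reduce_triple p q' t) (reduce_triple p q' t') (reduce_triple p q' t'')"
proof -
  obtain c s l where t: "t = (c, s, l)" by (metis prod_cases3)
  obtain c' s' l' where t': "t' = (c', s', l')" by (metis prod_cases3)
  obtain c'' s'' l'' where t'': "t'' = (c'', s'', l'')" by (metis prod_cases3)
  have "int p ^ q' dvd m" using assms by (simp add: le_imp_power_dvd)
  then have "triple_prod (int p ^ q') k t t' t''"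
    using assms(2) by (auto simp: t t' t'' elim: cong_dvd_modulus)
  then have *: "[(1 + k * s * c') * c'' = c + l * c'] (mod int p ^ q')"
    "[(1 + k * s * c') * s'' = l' * s + s'] (mod int p ^ q')"
    "[(1 + k * s * c') * l'' = l * l' + k * c * s'] (mod int p ^ q')"
    by (simp_all add: t t' t'')
  have tr: "[x' = y'] (mod int p ^ q')"
    if "[x = y] (mod int p ^ q')" "[x' = x] (mod int p ^ q')" "[y' = y] (mod int p ^ q')" for x y x' y'
    using that by (meson cong_sym cong_trans)
  have md: "[x mod int p ^ q' = x] (mod int p ^ q')" for x
    by (simp add: cong_def)
  show ?thesis
    unfolding t t' t'' reduce_triple.simps triple_prod.simps
  proof (intro conjI, goal_cases)
    case 1
    show ?case by (rule tr[OF *(1)]) (intro cong_mult cong_add cong_refl md)+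
  next
    case 2
    show ?case by (rule tr[OF *(2)]) (intro cong_mult cong_add cong_refl md)+
  next
    case 3
    show ?case by (rule tr[OF *(3)]) (intro cong_mult cong_add cong_refl md)+
  qed
qed

end

context
  fixes p r :: nat and \<chi> :: "nat \<Rightarrow> (nat \<Rightarrow> int) set \<Rightarrow> complex"
  assumes cm: "\<And>q. q \<ge> 1 \<Longrightarrow> character_matrix p r q (\<chi> q)"
begin

text \<open>The definite description in \<open>transition\<close> has a unique solution because
  triples are determined by their classes.\<close>

lemma transition_class:
  assumes "q \<ge> 2" "t \<in> triples p q"
  shows "transition p r \<chi> q (triple_class p r q (\<chi> q) t) =
    triple_class p r (q - 1) (\<chi> (q - 1)) (reduce_triple p (q - 1) t)"
proof -
  interpret character_matrix p r q "\<chi> q" using cm assms by simp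
  have "(THE u. u \<in> triples p q \<and> class t = class u) = t"
    using assms triple_class_inj by (intro the_equality) auto
  then show ?thesis by (simp add: transition_def)
qed

text \<open>Products at both levels are governed by \<open>triple_prod\<close>, which does not
  mention a character and survives reduction, so the map is multiplicative although the characters
  of the two levels are unrelated.\<close>

lemma transition_hom:
  assumes q: "q \<ge> 2"
  shows "group_hom (proj_mon_aut p r q (\<chi> q)) (proj_mon_aut p r (q - 1) (\<chi> (q - 1))) (transition p r \<chi> q)"
proof -
  interpret A: character_matrix p r q "\<chi> q" using cm q by simp
  interpret B: character_matrix p r "q - 1" "\<chi> (q - 1)" using cm q by simp
  have red: "reduce_triple p (q - 1) t \<in> triples p (q - 1)" if "t \<in> triples p q" for t
    using that q by (intro A.reduce_triple_mem) auto
  show ?thesis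
  proof (intro group_hom.intro group_hom_axioms.intro A.proj_mon_aut_group B.proj_mon_aut_group homI)
    fix x assume "x \<in> carrier A.P"
    then obtain t where t: "t \<in> triples p q" "x = A.class t"
      by (auto simp: A.carrier_proj_mon_aut)
    then show "transition p r \<chi> q x \<in> carrier B.P"
      unfolding t(2) transition_class[OF q t(1)] B.carrier_proj_mon_aut by (intro imageI red)
  next
    fix x y assume "x \<in> carrier A.P" "y \<in> carrier A.P"
    then obtain t t' where t: "t \<in> triples p q" "x = A.class t" "t' \<in> triples p q" "y = A.class t'"
      by (auto simp: A.carrier_proj_mon_aut)
    obtain t'' where t'': "t'' \<in> triples p q" "triple_prod (int p ^ q) (int p ^ r) t t' t''"
      using A.triple_prod_closed[OF t(1,3)] .
    have "transition p r \<chi> q (x \<otimes>\<^bsub>A.P\<^esub> y) = B.class (reduce_triple p (q - 1) t'')"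
      using t t'' q by (simp add: A.class_mult transition_class)
    also have "\<dots> = transition p r \<chi> q x \<otimes>\<^bsub>B.P\<^esub> transition p r \<chi> q y"
      unfolding t transition_class[OF q t(1)] transition_class[OF q t(3)]
      using A.reduce_triple_prod[OF _ t''(2), of "q - 1"]
      by (intro B.class_mult[symmetric] red t t'') simp
    finally show "transition p r \<chi> q (x \<otimes>\<^bsub>A.P\<^esub> y) = transition p r \<chi> q x \<otimes>\<^bsub>B.P\<^esub> transition p r \<chi> q y" .
  qed
qed

end

section \<open>Projective classes of two-by-two matrices\<close>

context cring
begin

lemma mat2_carrier: "Mat2 a b c d \<in> carrier (mat2_monoid R) \<longleftrightarrow>
    a \<in> carrier R \<and> b \<in> carrier R \<and> c \<in> carrier R \<and> d \<in> carrier R"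
  by (simp add: mat2_monoid_def)

lemma mat2_mult: "Mat2 a b c d \<otimes>\<^bsub>mat2_monoid R\<^esub> Mat2 a' b' c' d' =
    Mat2 (a \<otimes> a' \<oplus> b \<otimes> c') (a \<otimes> b' \<oplus> b \<otimes> d') (c \<otimes> a' \<oplus> d \<otimes> c') (c \<otimes> b' \<oplus> d \<otimes> d')"
  by (simp add: mat2_monoid_def)

lemma mat2_one: "\<one>\<^bsub>mat2_monoid R\<^esub> = Mat2 \<one> \<zero> \<zero> \<one>"
  by (simp add: mat2_monoid_def)

lemma mat2_monoid: "monoid (mat2_monoid R)"
proof (rule monoidI)
  fix A B C assume ABC: "A \<in> carrier (mat2_monoid R)" "B \<in> carrier (mat2_monoid R)"
    "C \<in> carrier (mat2_monoid R)"
  obtain a b c d where A: "A = Mat2 a b c d" by (cases A)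
  obtain a' b' c' d' where B: "B = Mat2 a' b' c' d'" by (cases B)
  obtain a'' b'' c'' d'' where C: "C = Mat2 a'' b'' c'' d''" by (cases C)
  show "A \<otimes>\<^bsub>mat2_monoid R\<^esub> B \<in> carrier (mat2_monoid R)"
    using ABC by (simp add: A B mat2_mult mat2_carrier)
  show "A \<otimes>\<^bsub>mat2_monoid R\<^esub> B \<otimes>\<^bsub>mat2_monoid R\<^esub> C = A \<otimes>\<^bsub>mat2_monoid R\<^esub> (B \<otimes>\<^bsub>mat2_monoid R\<^esub> C)"
    using ABC by (simp add: A B C mat2_mult mat2_carrier l_distr r_distr m_assoc a_ac)
  show "\<one>\<^bsub>mat2_monoid R\<^esub> \<otimes>\<^bsub>mat2_monoid R\<^esub> A = A" "A \<otimes>\<^bsub>mat2_monoid R\<^esub> \<one>\<^bsub>mat2_monoid R\<^esub> = A"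
    using ABC(1) by (simp_all add: A mat2_one mat2_mult mat2_carrier)
qed (simp add: mat2_one mat2_carrier)

lemma GL2_group: "group (GL2 R)"
  unfolding GL2_def by (rule monoid.units_group[OF mat2_monoid])

lemma GL2_mult: "A \<otimes>\<^bsub>GL2 R\<^esub> B = A \<otimes>\<^bsub>mat2_monoid R\<^esub> B"
  and GL2_one: "\<one>\<^bsub>GL2 R\<^esub> = Mat2 \<one> \<zero> \<zero> \<one>"
  by (simp_all add: GL2_def units_of_def mat2_one)

lemma GL2_carrier: "carrier (GL2 R) = Units (mat2_monoid R)"
  by (simp add: GL2_def units_of_carrier)

lemma GL2_closed: "Mat2 a b c d \<in> carrier (GL2 R) \<Longrightarrow>
    a \<in> carrier R \<and> b \<in> carrier R \<and> c \<in> carrier R \<and> d \<in> carrier R"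
  unfolding GL2_carrier Units_def by (simp add: mat2_carrier)

lemma mat2_in_GL2:
  assumes "a \<in> carrier R" "b \<in> carrier R" "c \<in> carrier R" "d \<in> carrier R"
    and "a \<otimes> d \<ominus> b \<otimes> c \<in> Units R"
  shows "Mat2 a b c d \<in> carrier (GL2 R)"
proof -
  define v where "v = inv (a \<otimes> d \<ominus> b \<otimes> c)"
  have v: "v \<in> carrier R" "v \<otimes> (a \<otimes> d \<ominus> b \<otimes> c) = \<one>"
    using assms(5) by (simp_all add: v_def)
  have v': "v \<otimes> (a \<otimes> d) \<ominus> v \<otimes> (b \<otimes> c) = \<one>"
    using v assms(1-4) by (simp add: a_minus_def r_distr r_minus)
  \<comment> \<open>The adjugate matrix multiplied by the inverse \<open>v\<close> of the
    determinant.\<close>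
  let ?B = "Mat2 (v \<otimes> d) (\<ominus> (v \<otimes> b)) (\<ominus> (v \<otimes> c)) (v \<otimes> a)"
  have "?B \<otimes>\<^bsub>mat2_monoid R\<^esub> Mat2 a b c d = \<one>\<^bsub>mat2_monoid R\<^esub>"
    "Mat2 a b c d \<otimes>\<^bsub>mat2_monoid R\<^esub> ?B = \<one>\<^bsub>mat2_monoid R\<^esub>"
    using assms(1-4) v(1) v'
    by (simp_all add: mat2_mult mat2_one a_minus_def l_minus r_minus m_ac a_ac r_neg l_neg)
  then show ?thesis
    using assms(1-4) v(1) unfolding GL2_carrier Units_def
    by (auto simp: mat2_carrier intro!: bexI[of _ ?B])
qed

lemma scalar_mat_mult:
  assumes "u \<in> carrier R" "a \<in> carrier R" "b \<in> carrier R" "c \<in> carrier R" "d \<in> carrier R"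
  shows "Mat2 u \<zero> \<zero> u \<otimes>\<^bsub>GL2 R\<^esub> Mat2 a b c d = Mat2 (u \<otimes> a) (u \<otimes> b) (u \<otimes> c) (u \<otimes> d)"
    and "Mat2 a b c d \<otimes>\<^bsub>GL2 R\<^esub> Mat2 u \<zero> \<zero> u = Mat2 (u \<otimes> a) (u \<otimes> b) (u \<otimes> c) (u \<otimes> d)"
  using assms by (simp_all add: GL2_mult mat2_mult m_comm)

lemma scalar_mats_normal: "scalar_mats R \<lhd> GL2 R"
proof -
  interpret G: group "GL2 R" by (rule GL2_group)
  have sub: "scalar_mats R \<subseteq> carrier (GL2 R)"
    by (auto simp: scalar_mats_def a_minus_def Units_closed intro!: mat2_in_GL2)
  have "subgroup (scalar_mats R) (GL2 R)"
  proof (rule G.subgroupI[OF sub])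
    show "scalar_mats R \<noteq> {}" by (auto simp: scalar_mats_def)
  next
    fix A assume "A \<in> scalar_mats R"
    then obtain u where u: "u \<in> Units R" "A = Mat2 u \<zero> \<zero> u" by (auto simp: scalar_mats_def)
    have B: "Mat2 (inv u) \<zero> \<zero> (inv u) \<in> scalar_mats R"
      using u by (auto simp: scalar_mats_def)
    have "Mat2 (inv u) \<zero> \<zero> (inv u) \<otimes>\<^bsub>GL2 R\<^esub> A = \<one>\<^bsub>GL2 R\<^esub>"
      using u by (simp add: scalar_mat_mult GL2_one Units_closed)
    then have "inv\<^bsub>GL2 R\<^esub> A = Mat2 (inv u) \<zero> \<zero> (inv u)"
      using B sub \<open>A \<in> scalar_mats R\<close> by (intro G.inv_equality) auto
    then show "inv\<^bsub>GL2 R\<^esub> A \<in> scalar_mats R" using B by simp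
  next
    fix A B assume "A \<in> scalar_mats R" "B \<in> scalar_mats R"
    then obtain u v where "u \<in> Units R" "A = Mat2 u \<zero> \<zero> u" "v \<in> Units R" "B = Mat2 v \<zero> \<zero> v"
      by (auto simp: scalar_mats_def)
    then show "A \<otimes>\<^bsub>GL2 R\<^esub> B \<in> scalar_mats R"
      by (auto simp: scalar_mat_mult scalar_mats_def Units_closed)
  qed
  moreover have "A \<otimes>\<^bsub>GL2 R\<^esub> h \<otimes>\<^bsub>GL2 R\<^esub> inv\<^bsub>GL2 R\<^esub> A \<in> scalar_mats R"
    if A: "A \<in> carrier (GL2 R)" and h: "h \<in> scalar_mats R" for A h
  proof -
    obtain a b c d where A_eq: "A = Mat2 a b c d" by (cases A)
    obtain u where "u \<in> Units R" "h = Mat2 u \<zero> \<zero> u" using h by (auto simp: scalar_mats_def)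
    then have "A \<otimes>\<^bsub>GL2 R\<^esub> h = h \<otimes>\<^bsub>GL2 R\<^esub> A"
      using GL2_closed[OF A[unfolded A_eq]] by (simp add: A_eq scalar_mat_mult Units_closed)
    then have "A \<otimes>\<^bsub>GL2 R\<^esub> h \<otimes>\<^bsub>GL2 R\<^esub> inv\<^bsub>GL2 R\<^esub> A = h"
      using A h sub by (simp add: G.m_assoc subsetD)
    then show ?thesis using h by simp
  qed
  ultimately show ?thesis
    by (simp add: G.normal_inv_iff)
qed

lemma PGL2_group: "group (PGL2 R)"
  unfolding PGL2_def by (rule normal.factorgroup_is_group[OF scalar_mats_normal])

lemma PGL2_class_mult:
  assumes "A \<in> carrier (GL2 R)" "B \<in> carrier (GL2 R)"
  shows "PGL2_class R A \<otimes>\<^bsub>PGL2 R\<^esub> PGL2_class R B = PGL2_class R (A \<otimes>\<^bsub>GL2 R\<^esub> B)"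
  using assms by (simp add: PGL2_def PGL2_class_def normal.rcos_sum[OF scalar_mats_normal])

lemma PGL2_class_scalar:
  assumes "u \<in> Units R" "Mat2 a b c d \<in> carrier (GL2 R)"
  shows "PGL2_class R (Mat2 (u \<otimes> a) (u \<otimes> b) (u \<otimes> c) (u \<otimes> d)) = PGL2_class R (Mat2 a b c d)"
proof -
  note closed = Units_closed[OF assms(1)] GL2_closed[OF assms(2)]
  interpret normal "scalar_mats R" "GL2 R" by (rule scalar_mats_normal)
  have "Mat2 u \<zero> \<zero> u \<in> scalar_mats R" using assms by (auto simp: scalar_mats_def)
  then have "PGL2_class R (Mat2 u \<zero> \<zero> u \<otimes>\<^bsub>GL2 R\<^esub> Mat2 a b c d) = PGL2_class R (Mat2 a b c d)"
    unfolding PGL2_class_def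
    using assms by (metis coset_mult_assoc coset_join2 mem_carrier subgroup_axioms subset)
  then show ?thesis
    using closed by (simp add: scalar_mat_mult)
qed

lemma PGL2_class_eqD:
  assumes "PGL2_class R (Mat2 a b c d) = PGL2_class R (Mat2 a' b' c' d')"
    and "Mat2 a b c d \<in> carrier (GL2 R)" "Mat2 a' b' c' d' \<in> carrier (GL2 R)"
  obtains u where "u \<in> Units R" "a = u \<otimes> a'" "b = u \<otimes> b'" "c = u \<otimes> c'" "d = u \<otimes> d'"
proof -
  note closed = GL2_closed[OF assms(3)] and R_Units_closed = Units_closed
  interpret normal "scalar_mats R" "GL2 R" by (rule scalar_mats_normal)
  have "Mat2 a b c d \<in> PGL2_class R (Mat2 a' b' c' d')"
    unfolding assms(1)[symmetric] unfolding PGL2_class_def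
    by (rule rcos_self[OF assms(2) subgroup_axioms])
  then obtain u where u: "u \<in> Units R" "Mat2 a b c d = Mat2 u \<zero> \<zero> u \<otimes>\<^bsub>GL2 R\<^esub> Mat2 a' b' c' d'"
    unfolding PGL2_class_def r_coset_def scalar_mats_def by blast
  then show ?thesis
    using closed R_Units_closed[OF u(1)]
    by (intro that[of u]) (simp_all add: scalar_mat_mult)
qed

lemma PGL2_one: "\<one>\<^bsub>PGL2 R\<^esub> = PGL2_class R (Mat2 \<one> \<zero> \<zero> \<one>)"
proof -
  interpret normal "scalar_mats R" "GL2 R" by (rule scalar_mats_normal)
  show ?thesis
    using coset_mult_one[OF subset] by (simp add: PGL2_def PGL2_class_def GL2_one)
qed

lemma carrier_PGL2: "carrier (PGL2 R) = PGL2_class R ` carrier (GL2 R)"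
  by (simp add: PGL2_def PGL2_class_def carrier_FactGroup)

end

text \<open>The parameter set itself never has to be made a group: it is enough that products on
  both sides are named by a common parameter \<open>z\<close>. The isomorphism is \<open>g\<close>
  after the inverse of \<open>f\<close>.\<close>

lemma is_isoI_common_parametrization:
  assumes f: "bij_betw f A (carrier G)" and g: "bij_betw g A (carrier H)"
    and prod: "\<And>x y. x \<in> A \<Longrightarrow> y \<in> A \<Longrightarrow> \<exists>z\<in>A. f x \<otimes>\<^bsub>G\<^esub> f y = f z \<and> g x \<otimes>\<^bsub>H\<^esub> g y = g z"
  shows "G \<cong> H"
proof -
  let ?h = "g \<circ> inv_into A f"
  have hf: "?h (f x) = g x" if "x \<in> A" for x
    using that f by (simp add: bij_betw_inv_into_left)
  have "bij_betw ?h (carrier G) (carrier H)"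
    using bij_betw_inv_into[OF f] g by (rule bij_betw_trans)
  moreover have "?h \<in> hom G H"
  proof (rule homI)
    fix x assume "x \<in> carrier G"
    then show "?h x \<in> carrier H"
      using calculation by (rule bij_betwE[THEN bspec, rotated])
  next
    fix x y assume "x \<in> carrier G" "y \<in> carrier G"
    then obtain a b where ab: "a \<in> A" "x = f a" "b \<in> A" "y = f b"
      using bij_betw_imp_surj_on[OF f] by blast
    then obtain z where "z \<in> A" "f a \<otimes>\<^bsub>G\<^esub> f b = f z" "g a \<otimes>\<^bsub>H\<^esub> g b = g z"
      using prod by blast
    then show "?h (x \<otimes>\<^bsub>G\<^esub> y) = ?h x \<otimes>\<^bsub>H\<^esub> ?h y"
      using ab hf by simp
  qed
  ultimately show ?thesis
    by (auto simp: is_iso_def iso_def)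
qed

section \<open>Triples of p-adic integers\<close>

text \<open>Applied as introduction rules, these follow the shape of a ring expression over
  \<open>Zp p\<close> and rebuild it as an integer expression in the entries at level
  \<open>n\<close>.\<close>

lemma Zp_mult_congI:
    "[x n = a] (mod int p ^ n) \<Longrightarrow> [y n = b] (mod int p ^ n) \<Longrightarrow> [(x \<otimes>\<^bsub>Zp p\<^esub> y) n = a * b] (mod int p ^ n)"
  and Zp_add_congI:
    "[x n = a] (mod int p ^ n) \<Longrightarrow> [y n = b] (mod int p ^ n) \<Longrightarrow> [(x \<oplus>\<^bsub>Zp p\<^esub> y) n = a + b] (mod int p ^ n)"
  and Zp_one_cong: "[\<one>\<^bsub>Zp p\<^esub> n = 1] (mod int p ^ n)"
  and Zp_of_int_cong: "[Zp_of_int p j n = j] (mod int p ^ n)"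
  using cong_mult[of "x n" a "int p ^ n" "y n" b] cong_add[of "x n" a "int p ^ n" "y n" b]
  by (simp_all add: cong_def Zp_ops Zp_of_int_at)

lemma Zp_eq_iff_cong:
  assumes "x \<in> carrier (Zp p)" "y \<in> carrier (Zp p)"
    and "\<And>n. [x n = a n] (mod int p ^ n)" "\<And>n. [y n = b n] (mod int p ^ n)"
  shows "x = y \<longleftrightarrow> (\<forall>n. [a n = b n] (mod int p ^ n))"
proof
  assume "x = y"
  then show "\<forall>n. [a n = b n] (mod int p ^ n)"
    using assms(3,4) by (metis cong_sym cong_trans)
next
  assume "\<forall>n. [a n = b n] (mod int p ^ n)"
  then have "[x n = y n] (mod int p ^ n)" for n
    using assms(3,4) by (metis cong_sym cong_trans)
  then show "x = y"
    by (rule Zp_eqI[OF assms(1,2)])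
qed

type_synonym padic_triple = "(nat \<Rightarrow> int) \<times> (nat \<Rightarrow> int) \<times> (nat \<Rightarrow> int)"

definition Zp_triples :: "nat \<Rightarrow> padic_triple set" where
  "Zp_triples p = carrier (Zp p) \<times> carrier (Zp p) \<times> Units (Zp p)"

fun triple_at :: "nat \<Rightarrow> padic_triple \<Rightarrow> int \<times> int \<times> int" where
  "triple_at n (c, s, l) = (c n, s n, l n)"

text \<open>The levelwise form passes directly to each group of the tower;
  \<open>Zp_triple_prod_iff\<close> translates it into the ring identities needed for matrices.
  Level 0 has modulus 1 and imposes nothing.\<close>

definition Zp_triple_prod :: "nat \<Rightarrow> int \<Rightarrow> padic_triple \<Rightarrow> padic_triple \<Rightarrow> padic_triple \<Rightarrow> bool" where
  "Zp_triple_prod p k t t' t'' \<longleftrightarrow>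
    (\<forall>n. triple_prod (int p ^ n) k (triple_at n t) (triple_at n t') (triple_at n t''))"

locale padic =
  fixes p r :: nat
  assumes prime: "Factorial_Ring.prime p" and r: "r \<ge> 1"
begin

lemma p_pos: "p > 0"
  using prime_gt_0_nat[OF prime] .

sublocale Zp: cring "Zp p"
  by (rule Zp_cring[OF p_pos])

abbreviation "Z \<equiv> Zp p"
abbreviation "K \<equiv> Zp_of_int p (int p ^ r)"

lemma K_closed: "K \<in> carrier Z"
  by (rule Zp_of_int_closed[OF p_pos])

lemma Zp_triples_iff: "(c, s, l) \<in> Zp_triples p \<longleftrightarrow> c \<in> carrier Z \<and> s \<in> carrier Z \<and> l \<in> Units Z"
  by (simp add: Zp_triples_def)

lemma K_at_1: "K 1 = 0"
  using r by (simp add: Zp_of_int_at)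

text \<open>Whether an element is a unit is decided at level 1, where \<open>K\<close> vanishes
  because \<open>r \<ge> 1\<close>.\<close>

lemma Units_add_K:
  assumes "y \<in> Units Z" "x \<in> carrier Z"
  shows "y \<oplus>\<^bsub>Z\<^esub> K \<otimes>\<^bsub>Z\<^esub> x \<in> Units Z"
proof -
  have "(y \<oplus>\<^bsub>Z\<^esub> K \<otimes>\<^bsub>Z\<^esub> x) 1 = y 1"
    using Zp_mod_self[of y p 1] Zp.Units_closed[OF assms(1)] K_at_1 by (simp add: Zp_ops)
  then show ?thesis
    using assms K_closed by (simp add: Zp_Units_iff[OF prime])
qed

lemma Units_1_plus: "x \<in> carrier Z \<Longrightarrow> \<one>\<^bsub>Z\<^esub> \<oplus>\<^bsub>Z\<^esub> K \<otimes>\<^bsub>Z\<^esub> x \<in> Units Z"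
  by (rule Units_add_K) auto

lemma Zp_triple_prod_iff:
  assumes "(c, s, l) \<in> Zp_triples p" "(c', s', l') \<in> Zp_triples p" "(c'', s'', l'') \<in> Zp_triples p"
  shows "Zp_triple_prod p (int p ^ r) (c, s, l) (c', s', l') (c'', s'', l'') \<longleftrightarrow>
    (\<one>\<^bsub>Z\<^esub> \<oplus>\<^bsub>Z\<^esub> K \<otimes>\<^bsub>Z\<^esub> s \<otimes>\<^bsub>Z\<^esub> c') \<otimes>\<^bsub>Z\<^esub> c'' = c \<oplus>\<^bsub>Z\<^esub> l \<otimes>\<^bsub>Z\<^esub> c' \<and>
    (\<one>\<^bsub>Z\<^esub> \<oplus>\<^bsub>Z\<^esub> K \<otimes>\<^bsub>Z\<^esub> s \<otimes>\<^bsub>Z\<^esub> c') \<otimes>\<^bsub>Z\<^esub> s'' = l' \<otimes>\<^bsub>Z\<^esub> s \<oplus>\<^bsub>Z\<^esub> s' \<and>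
    (\<one>\<^bsub>Z\<^esub> \<oplus>\<^bsub>Z\<^esub> K \<otimes>\<^bsub>Z\<^esub> s \<otimes>\<^bsub>Z\<^esub> c') \<otimes>\<^bsub>Z\<^esub> l'' = l \<otimes>\<^bsub>Z\<^esub> l' \<oplus>\<^bsub>Z\<^esub> K \<otimes>\<^bsub>Z\<^esub> c \<otimes>\<^bsub>Z\<^esub> s'"
proof -
  have mem: "c \<in> carrier Z" "s \<in> carrier Z" "l \<in> carrier Z" "c' \<in> carrier Z" "s' \<in> carrier Z"
    "l' \<in> carrier Z" "c'' \<in> carrier Z" "s'' \<in> carrier Z" "l'' \<in> carrier Z"
    using assms by (auto simp: Zp_triples_iff Zp.Units_closed)
  note congs = Zp_mult_congI Zp_add_congI Zp_one_cong Zp_of_int_cong cong_refl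
  have 1: "(\<one>\<^bsub>Z\<^esub> \<oplus>\<^bsub>Z\<^esub> K \<otimes>\<^bsub>Z\<^esub> s \<otimes>\<^bsub>Z\<^esub> c') \<otimes>\<^bsub>Z\<^esub> c'' = c \<oplus>\<^bsub>Z\<^esub> l \<otimes>\<^bsub>Z\<^esub> c' \<longleftrightarrow>
    (\<forall>n. [(1 + int p ^ r * s n * c' n) * c'' n = c n + l n * c' n] (mod int p ^ n))"
    using mem K_closed by (intro Zp_eq_iff_cong) (simp_all, (intro congs)+)
  have 2: "(\<one>\<^bsub>Z\<^esub> \<oplus>\<^bsub>Z\<^esub> K \<otimes>\<^bsub>Z\<^esub> s \<otimes>\<^bsub>Z\<^esub> c') \<otimes>\<^bsub>Z\<^esub> s'' = l' \<otimes>\<^bsub>Z\<^esub> s \<oplus>\<^bsub>Z\<^esub> s' \<longleftrightarrow>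
    (\<forall>n. [(1 + int p ^ r * s n * c' n) * s'' n = l' n * s n + s' n] (mod int p ^ n))"
    using mem K_closed by (intro Zp_eq_iff_cong) (simp_all, (intro congs)+)
  have 3: "(\<one>\<^bsub>Z\<^esub> \<oplus>\<^bsub>Z\<^esub> K \<otimes>\<^bsub>Z\<^esub> s \<otimes>\<^bsub>Z\<^esub> c') \<otimes>\<^bsub>Z\<^esub> l'' = l \<otimes>\<^bsub>Z\<^esub> l' \<oplus>\<^bsub>Z\<^esub> K \<otimes>\<^bsub>Z\<^esub> c \<otimes>\<^bsub>Z\<^esub> s' \<longleftrightarrow>
    (\<forall>n. [(1 + int p ^ r * s n * c' n) * l'' n = l n * l' n + int p ^ r * c n * s' n] (mod int p ^ n))"
    using mem K_closed by (intro Zp_eq_iff_cong) (simp_all, (intro congs)+)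
  show ?thesis
    unfolding 1 2 3 Zp_triple_prod_def triple_at.simps triple_prod.simps by blast
qed

lemma Zp_triple_prod_closed:
  assumes "t \<in> Zp_triples p" "t' \<in> Zp_triples p"
  obtains t'' where "t'' \<in> Zp_triples p" "Zp_triple_prod p (int p ^ r) t t' t''"
proof -
  obtain c s l where t: "t = (c, s, l)" by (metis prod_cases3)
  obtain c' s' l' where t': "t' = (c', s', l')" by (metis prod_cases3)
  have mem: "c \<in> carrier Z" "s \<in> carrier Z" "l \<in> carrier Z" "c' \<in> carrier Z" "s' \<in> carrier Z"
    "l' \<in> carrier Z" and U: "l \<in> Units Z" "l' \<in> Units Z"
    using assms by (auto simp: t t' Zp_triples_iff Zp.Units_closed)
  define u v where "u = \<one>\<^bsub>Z\<^esub> \<oplus>\<^bsub>Z\<^esub> K \<otimes>\<^bsub>Z\<^esub> s \<otimes>\<^bsub>Z\<^esub> c'" and "v = inv\<^bsub>Z\<^esub> u"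
  have u: "u \<in> Units Z"
    using Units_1_plus[of "s \<otimes>\<^bsub>Z\<^esub> c'"] mem K_closed by (simp add: u_def Zp.m_assoc)
  then have v: "v \<in> Units Z" by (simp add: v_def)
  have uv: "u \<otimes>\<^bsub>Z\<^esub> (v \<otimes>\<^bsub>Z\<^esub> x) = x" if "x \<in> carrier Z" for x
    using u that by (simp add: v_def Zp.Units_closed flip: Zp.m_assoc)
  have num: "l \<otimes>\<^bsub>Z\<^esub> l' \<oplus>\<^bsub>Z\<^esub> K \<otimes>\<^bsub>Z\<^esub> c \<otimes>\<^bsub>Z\<^esub> s' \<in> Units Z"
    using Units_add_K[of "l \<otimes>\<^bsub>Z\<^esub> l'" "c \<otimes>\<^bsub>Z\<^esub> s'"] U mem K_closed by (simp add: Zp.m_assoc)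
  let ?t = "(v \<otimes>\<^bsub>Z\<^esub> (c \<oplus>\<^bsub>Z\<^esub> l \<otimes>\<^bsub>Z\<^esub> c'), v \<otimes>\<^bsub>Z\<^esub> (l' \<otimes>\<^bsub>Z\<^esub> s \<oplus>\<^bsub>Z\<^esub> s'),
    v \<otimes>\<^bsub>Z\<^esub> (l \<otimes>\<^bsub>Z\<^esub> l' \<oplus>\<^bsub>Z\<^esub> K \<otimes>\<^bsub>Z\<^esub> c \<otimes>\<^bsub>Z\<^esub> s'))"
  have T: "?t \<in> Zp_triples p"
    using mem v num by (simp add: Zp_triples_iff Zp.Units_closed)
  moreover have "Zp_triple_prod p (int p ^ r) t t' ?t"
    using mem K_closed uv
    unfolding t t' Zp_triple_prod_iff[OF assms[unfolded t t'] T] u_def[symmetric] by simp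
  ultimately show ?thesis by (rule that)
qed

subsection \<open>The matrix of a triple\<close>

fun triple_matrix :: "padic_triple \<Rightarrow> (nat \<Rightarrow> int) mat2" where
  "triple_matrix (c, s, l) = Mat2 l c (K \<otimes>\<^bsub>Z\<^esub> s) \<one>\<^bsub>Z\<^esub>"

text \<open>With \<open>c\<close> and \<open>s\<close> exchanged as in the matrix of the row permutation; the matrix of the column
  permutation would reverse products.\<close>

definition matrix_class :: "padic_triple \<Rightarrow> (nat \<Rightarrow> int) mat2 set" where
  "matrix_class t = PGL2_class Z (triple_matrix t)"

text \<open>The determinant is \<open>l\<close> plus a multiple of \<open>K\<close>, hence a unit
  together with \<open>l\<close>.\<close>

lemma triple_matrix_in_GL2:
  assumes "t \<in> Zp_triples p"
  shows "triple_matrix t \<in> carrier (GL2 Z)"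
proof -
  obtain c s l where t: "t = (c, s, l)" by (metis prod_cases3)
  have mem: "c \<in> carrier Z" "s \<in> carrier Z" "l \<in> Units Z" "l \<in> carrier Z"
    using assms by (auto simp: t Zp_triples_iff Zp.Units_closed)
  have "l \<oplus>\<^bsub>Z\<^esub> K \<otimes>\<^bsub>Z\<^esub> (\<ominus>\<^bsub>Z\<^esub> (c \<otimes>\<^bsub>Z\<^esub> s)) \<in> Units Z"
    using mem by (intro Units_add_K) auto
  also have "l \<oplus>\<^bsub>Z\<^esub> K \<otimes>\<^bsub>Z\<^esub> (\<ominus>\<^bsub>Z\<^esub> (c \<otimes>\<^bsub>Z\<^esub> s)) = l \<otimes>\<^bsub>Z\<^esub> \<one>\<^bsub>Z\<^esub> \<ominus>\<^bsub>Z\<^esub> c \<otimes>\<^bsub>Z\<^esub> (K \<otimes>\<^bsub>Z\<^esub> s)"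
    using mem K_closed by (simp add: a_minus_def Zp.r_minus Zp.m_lcomm)
  finally show ?thesis
    using mem K_closed by (simp add: t Zp.mat2_in_GL2)
qed

lemma matrix_class_mult:
  assumes "t \<in> Zp_triples p" "t' \<in> Zp_triples p" "t'' \<in> Zp_triples p"
    and "Zp_triple_prod p (int p ^ r) t t' t''"
  shows "matrix_class t \<otimes>\<^bsub>PGL2 Z\<^esub> matrix_class t' = matrix_class t''"
proof -
  obtain c s l where t: "t = (c, s, l)" by (metis prod_cases3)
  obtain c' s' l' where t': "t' = (c', s', l')" by (metis prod_cases3)
  obtain c'' s'' l'' where t'': "t'' = (c'', s'', l'')" by (metis prod_cases3)
  have mem: "c \<in> carrier Z" "s \<in> carrier Z" "l \<in> carrier Z" "c' \<in> carrier Z" "s' \<in> carrier Z"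
    "l' \<in> carrier Z" "c'' \<in> carrier Z" "s'' \<in> carrier Z" "l'' \<in> carrier Z"
    using assms by (auto simp: t t' t'' Zp_triples_iff Zp.Units_closed)
  define u where "u = \<one>\<^bsub>Z\<^esub> \<oplus>\<^bsub>Z\<^esub> K \<otimes>\<^bsub>Z\<^esub> s \<otimes>\<^bsub>Z\<^esub> c'"
  have uU: "u \<in> Units Z"
    using Units_1_plus[of "s \<otimes>\<^bsub>Z\<^esub> c'"] mem K_closed by (simp add: u_def Zp.m_assoc)
  then have uc: "u \<in> carrier Z" by (rule Zp.Units_closed)
  have eqs: "u \<otimes>\<^bsub>Z\<^esub> c'' = c \<oplus>\<^bsub>Z\<^esub> l \<otimes>\<^bsub>Z\<^esub> c'" "u \<otimes>\<^bsub>Z\<^esub> s'' = l' \<otimes>\<^bsub>Z\<^esub> s \<oplus>\<^bsub>Z\<^esub> s'"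
    "u \<otimes>\<^bsub>Z\<^esub> l'' = l \<otimes>\<^bsub>Z\<^esub> l' \<oplus>\<^bsub>Z\<^esub> K \<otimes>\<^bsub>Z\<^esub> c \<otimes>\<^bsub>Z\<^esub> s'"
    using assms(4) Zp_triple_prod_iff[OF assms(1-3)[unfolded t t' t'']]
    by (simp_all only: t t' t'' u_def)
  have "u \<otimes>\<^bsub>Z\<^esub> (K \<otimes>\<^bsub>Z\<^esub> s'') = K \<otimes>\<^bsub>Z\<^esub> (u \<otimes>\<^bsub>Z\<^esub> s'')"
    using uc mem K_closed by (simp add: Zp.m_lcomm)
  then have eqs': "u \<otimes>\<^bsub>Z\<^esub> (K \<otimes>\<^bsub>Z\<^esub> s'') = K \<otimes>\<^bsub>Z\<^esub> (l' \<otimes>\<^bsub>Z\<^esub> s \<oplus>\<^bsub>Z\<^esub> s')"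
    by (simp only: eqs)
  \<comment> \<open>The lower-right entry of the product is \<open>u\<close>, so dividing by it
    restores the normal form with 1 in that corner; the other entries then carry the components of
    \<open>t''\<close>.\<close>
  have "triple_matrix t \<otimes>\<^bsub>GL2 Z\<^esub> triple_matrix t' =
    Mat2 (u \<otimes>\<^bsub>Z\<^esub> l'') (u \<otimes>\<^bsub>Z\<^esub> c'') (u \<otimes>\<^bsub>Z\<^esub> (K \<otimes>\<^bsub>Z\<^esub> s'')) (u \<otimes>\<^bsub>Z\<^esub> \<one>\<^bsub>Z\<^esub>)"
    unfolding eqs eqs' Zp.r_one[OF uc] t t' triple_matrix.simps Zp.GL2_mult Zp.mat2_mult mat2.inject
  proof (intro conjI)
    show "l \<otimes>\<^bsub>Z\<^esub> l' \<oplus>\<^bsub>Z\<^esub> c \<otimes>\<^bsub>Z\<^esub> (K \<otimes>\<^bsub>Z\<^esub> s') = l \<otimes>\<^bsub>Z\<^esub> l' \<oplus>\<^bsub>Z\<^esub> K \<otimes>\<^bsub>Z\<^esub> c \<otimes>\<^bsub>Z\<^esub> s'"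
      using mem K_closed by (simp add: Zp.m_assoc Zp.m_lcomm[of c K])
    show "l \<otimes>\<^bsub>Z\<^esub> c' \<oplus>\<^bsub>Z\<^esub> c \<otimes>\<^bsub>Z\<^esub> \<one>\<^bsub>Z\<^esub> = c \<oplus>\<^bsub>Z\<^esub> l \<otimes>\<^bsub>Z\<^esub> c'"
      using mem by (simp add: Zp.a_comm[of c])
    show "K \<otimes>\<^bsub>Z\<^esub> s \<otimes>\<^bsub>Z\<^esub> l' \<oplus>\<^bsub>Z\<^esub> \<one>\<^bsub>Z\<^esub> \<otimes>\<^bsub>Z\<^esub> (K \<otimes>\<^bsub>Z\<^esub> s') = K \<otimes>\<^bsub>Z\<^esub> (l' \<otimes>\<^bsub>Z\<^esub> s \<oplus>\<^bsub>Z\<^esub> s')"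
      using mem K_closed by (simp add: Zp.m_assoc Zp.r_distr Zp.m_comm[of l'])
    show "K \<otimes>\<^bsub>Z\<^esub> s \<otimes>\<^bsub>Z\<^esub> c' \<oplus>\<^bsub>Z\<^esub> \<one>\<^bsub>Z\<^esub> \<otimes>\<^bsub>Z\<^esub> \<one>\<^bsub>Z\<^esub> = u"
      using mem K_closed by (simp add: u_def Zp.a_comm[of "\<one>\<^bsub>Z\<^esub>"])
  qed
  then have "matrix_class t \<otimes>\<^bsub>PGL2 Z\<^esub> matrix_class t' =
      PGL2_class Z (Mat2 (u \<otimes>\<^bsub>Z\<^esub> l'') (u \<otimes>\<^bsub>Z\<^esub> c'') (u \<otimes>\<^bsub>Z\<^esub> (K \<otimes>\<^bsub>Z\<^esub> s'')) (u \<otimes>\<^bsub>Z\<^esub> \<one>\<^bsub>Z\<^esub>))"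
    unfolding matrix_class_def by (simp add: Zp.PGL2_class_mult triple_matrix_in_GL2 assms)
  also have "\<dots> = matrix_class t''"
    using triple_matrix_in_GL2[OF assms(3)] uU unfolding matrix_class_def t'' triple_matrix.simps
    by (intro Zp.PGL2_class_scalar)
  finally show ?thesis .
qed

text \<open>Multiplication by \<open>p ^ r\<close> shifts precision by \<open>r\<close>: the
  products are compared at level \<open>r + n\<close> to obtain a statement about \<open>x\<close>
  and \<open>y\<close> at level \<open>n\<close>.\<close>

lemma K_cancel:
  assumes "x \<in> carrier Z" "y \<in> carrier Z" "K \<otimes>\<^bsub>Z\<^esub> x = K \<otimes>\<^bsub>Z\<^esub> y"
  shows "x = y"
proof (rule Zp_eqI[OF assms(1,2)])
  fix n
  have "[(K \<otimes>\<^bsub>Z\<^esub> x) (r + n) = int p ^ r * x (r + n)] (mod int p ^ (r + n))"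
    "[(K \<otimes>\<^bsub>Z\<^esub> y) (r + n) = int p ^ r * y (r + n)] (mod int p ^ (r + n))"
    by (intro Zp_mult_congI Zp_of_int_cong cong_refl)+
  then have "[int p ^ r * x (r + n) = int p ^ r * y (r + n)] (mod int p ^ r * int p ^ n)"
    unfolding assms(3) power_add[symmetric] by (meson cong_sym cong_trans)
  then have "[x (r + n) = y (r + n)] (mod int p ^ n)"
    using p_pos by (simp add: cong_iff_dvd_diff flip: right_diff_distrib)
  then show "[x n = y n] (mod int p ^ n)"
    using Zp_mod_le[OF assms(1), of n "r + n"] Zp_mod_le[OF assms(2), of n "r + n"]
    by (simp add: cong_def)
qed

text \<open>The roles of \<open>c\<close> and \<open>s\<close> are interchanged between the two
  descriptions; the sets agree because both components range over all of
  \<open>Zp p\<close>.\<close>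

lemma limit_matrix_classes_eq: "limit_matrix_classes p r = matrix_class ` Zp_triples p"
proof (intro equalityI subsetI)
  fix M assume "M \<in> limit_matrix_classes p r"
  then obtain c s l where "c \<in> carrier Z" "s \<in> carrier Z" "l \<in> Units Z"
    and M: "M = PGL2_class Z (Mat2 l s (K \<otimes>\<^bsub>Z\<^esub> c) \<one>\<^bsub>Z\<^esub>)"
    unfolding limit_matrix_classes_def by blast
  then have "(s, c, l) \<in> Zp_triples p" by (simp add: Zp_triples_iff)
  moreover have "M = matrix_class (s, c, l)" by (simp only: M matrix_class_def triple_matrix.simps)
  ultimately show "M \<in> matrix_class ` Zp_triples p" by blast
next
  fix M assume "M \<in> matrix_class ` Zp_triples p"
  then obtain c s l where "(c, s, l) \<in> Zp_triples p" "M = matrix_class (c, s, l)" by auto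
  then show "M \<in> limit_matrix_classes p r"
    unfolding limit_matrix_classes_def matrix_class_def triple_matrix.simps Zp_triples_iff by blast
qed

text \<open>Equal classes differ by a unit scalar, and the corner entries 1 force that scalar to be
  1.\<close>

lemma matrix_class_inj: "inj_on matrix_class (Zp_triples p)"
proof (rule inj_onI)
  fix t t' assume T: "t \<in> Zp_triples p" "t' \<in> Zp_triples p" and eq: "matrix_class t = matrix_class t'"
  obtain c s l where t: "t = (c, s, l)" by (metis prod_cases3)
  obtain c' s' l' where t': "t' = (c', s', l')" by (metis prod_cases3)
  have mem: "c \<in> carrier Z" "s \<in> carrier Z" "l \<in> carrier Z" "c' \<in> carrier Z" "s' \<in> carrier Z"
    "l' \<in> carrier Z"
    using T by (auto simp: t t' Zp_triples_iff Zp.Units_closed)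
  obtain u where u: "u \<in> Units Z" "l = u \<otimes>\<^bsub>Z\<^esub> l'" "c = u \<otimes>\<^bsub>Z\<^esub> c'"
    "K \<otimes>\<^bsub>Z\<^esub> s = u \<otimes>\<^bsub>Z\<^esub> (K \<otimes>\<^bsub>Z\<^esub> s')" "\<one>\<^bsub>Z\<^esub> = u \<otimes>\<^bsub>Z\<^esub> \<one>\<^bsub>Z\<^esub>"
    by (rule Zp.PGL2_class_eqD[OF eq[unfolded matrix_class_def t t' triple_matrix.simps]
          triple_matrix_in_GL2[OF T(1), unfolded t triple_matrix.simps]
          triple_matrix_in_GL2[OF T(2), unfolded t' triple_matrix.simps]])
  have "u = \<one>\<^bsub>Z\<^esub>" using u(5) Zp.Units_closed[OF u(1)] by simp
  then have "l = l'" "c = c'" "K \<otimes>\<^bsub>Z\<^esub> s = K \<otimes>\<^bsub>Z\<^esub> s'"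
    using u(2-4) mem K_closed by simp_all
  then show "t = t'"
    using K_cancel mem by (simp add: t t')
qed

lemma matrix_class_bij: "bij_betw matrix_class (Zp_triples p) (limit_matrix_classes p r)"
  using matrix_class_inj by (simp add: bij_betw_def limit_matrix_classes_eq)

lemma limit_matrix_classes_subgroup: "subgroup (limit_matrix_classes p r) (PGL2 Z)"
proof -
  interpret G: group "PGL2 Z" by (rule Zp.PGL2_group)
  have sub: "matrix_class ` Zp_triples p \<subseteq> carrier (PGL2 Z)"
    unfolding Zp.carrier_PGL2 matrix_class_def using triple_matrix_in_GL2 by blast
  define e where "e = (\<zero>\<^bsub>Z\<^esub>, \<zero>\<^bsub>Z\<^esub>, \<one>\<^bsub>Z\<^esub>)"
  have e: "e \<in> Zp_triples p" "matrix_class e = \<one>\<^bsub>PGL2 Z\<^esub>"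
    using K_closed by (simp_all add: e_def Zp_triples_iff matrix_class_def Zp.PGL2_one)
  show ?thesis
    unfolding limit_matrix_classes_eq
  proof (rule G.subgroupI[OF sub])
    show "matrix_class ` Zp_triples p \<noteq> {}" using e by auto
  next
    fix a assume "a \<in> matrix_class ` Zp_triples p"
    then obtain c s l where t: "(c, s, l) \<in> Zp_triples p" and a: "a = matrix_class (c, s, l)" by auto
    have mem: "c \<in> carrier Z" "s \<in> carrier Z" "l \<in> carrier Z" "l \<in> Units Z" "inv\<^bsub>Z\<^esub> l \<in> carrier Z"
      using t by (auto simp: Zp_triples_iff Zp.Units_closed)
    \<comment> \<open>These are the entries of the adjugate of the matrix of
      \<open>(c, s, l)\<close>, which represents the inverse class, divided by \<open>l\<close> to
      make its lower-right entry 1.\<close>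
    define t' where "t' = (\<ominus>\<^bsub>Z\<^esub> (inv\<^bsub>Z\<^esub> l \<otimes>\<^bsub>Z\<^esub> c), \<ominus>\<^bsub>Z\<^esub> (inv\<^bsub>Z\<^esub> l \<otimes>\<^bsub>Z\<^esub> s), inv\<^bsub>Z\<^esub> l)"
    have t': "t' \<in> Zp_triples p"
      using mem by (simp add: t'_def Zp_triples_iff)
    have *: "l \<otimes>\<^bsub>Z\<^esub> (inv\<^bsub>Z\<^esub> l \<otimes>\<^bsub>Z\<^esub> c) = c"
      using mem by (simp flip: Zp.m_assoc)
    have "Zp_triple_prod p (int p ^ r) (c, s, l) t' e"
      using mem K_closed *
      unfolding t'_def e_def Zp_triple_prod_iff[OF t t'[unfolded t'_def] e(1)[unfolded e_def]]
      by (simp add: Zp.r_minus Zp.r_neg Zp.m_ac)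
    then have "a \<otimes>\<^bsub>PGL2 Z\<^esub> matrix_class t' = \<one>\<^bsub>PGL2 Z\<^esub>"
      using matrix_class_mult[OF t t' e(1)] e(2) a by simp
    moreover have "a \<in> carrier (PGL2 Z)" "matrix_class t' \<in> carrier (PGL2 Z)"
      using sub t t' a by auto
    ultimately have "inv\<^bsub>PGL2 Z\<^esub> a = matrix_class t'"
      by (metis G.inv_equality G.inv_inv)
    then show "inv\<^bsub>PGL2 Z\<^esub> a \<in> matrix_class ` Zp_triples p" using t' by simp
  next
    fix a b assume "a \<in> matrix_class ` Zp_triples p" "b \<in> matrix_class ` Zp_triples p"
    then obtain t t' where t: "t \<in> Zp_triples p" "a = matrix_class t" "t' \<in> Zp_triples p" "b = matrix_class t'"
      by auto
    obtain t'' where "t'' \<in> Zp_triples p" "Zp_triple_prod p (int p ^ r) t t' t''"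
      using Zp_triple_prod_closed[OF t(1,3)] .
    then show "a \<otimes>\<^bsub>PGL2 Z\<^esub> b \<in> matrix_class ` Zp_triples p"
      using t by (simp add: matrix_class_mult)
  qed
qed

section \<open>Comparison with the congruence subgroup\<close>

lemma Zp_eq_0_at_1:
  assumes "x \<in> carrier Z" "x r = 0"
  shows "x 1 = 0"
  using Zp_mod_le[OF assms(1) r] assms(2) by simp

text \<open>Modulo \<open>p\<close> the matrix is upper triangular, because \<open>c\<close>
  vanishes at level 1. With an inverse matrix on either side, one diagonal entry of each product
  then shows that \<open>a\<close> and \<open>d\<close> are invertible modulo
  \<open>p\<close>.\<close>

lemma Gamma0_diagonal_Units:
  assumes A: "Mat2 a b c d \<in> carrier (GL2 Z)" and c: "c r = 0"
  shows "a \<in> Units Z" "d \<in> Units Z"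
proof -
  have p1: "int p > 1" using prime_gt_1_nat[OF prime] by simp
  note mem = Zp.GL2_closed[OF A]
  have c1: "c 1 = 0" using Zp_eq_0_at_1 mem c by blast
  obtain B where B: "B \<in> carrier (mat2_monoid Z)"
    "B \<otimes>\<^bsub>mat2_monoid Z\<^esub> Mat2 a b c d = Mat2 \<one>\<^bsub>Z\<^esub> \<zero>\<^bsub>Z\<^esub> \<zero>\<^bsub>Z\<^esub> \<one>\<^bsub>Z\<^esub>"
    "Mat2 a b c d \<otimes>\<^bsub>mat2_monoid Z\<^esub> B = Mat2 \<one>\<^bsub>Z\<^esub> \<zero>\<^bsub>Z\<^esub> \<zero>\<^bsub>Z\<^esub> \<one>\<^bsub>Z\<^esub>"
    using A unfolding Zp.GL2_carrier Units_def Zp.mat2_one by blast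
  obtain a' b' c' d' where B_eq: "B = Mat2 a' b' c' d'" by (cases B)
  have "(a' \<otimes>\<^bsub>Z\<^esub> a \<oplus>\<^bsub>Z\<^esub> b' \<otimes>\<^bsub>Z\<^esub> c) 1 = \<one>\<^bsub>Z\<^esub> 1" "(c \<otimes>\<^bsub>Z\<^esub> b' \<oplus>\<^bsub>Z\<^esub> d \<otimes>\<^bsub>Z\<^esub> d') 1 = \<one>\<^bsub>Z\<^esub> 1"
    using B(2,3) by (simp_all add: B_eq Zp.mat2_mult)
  then have "a' 1 * a 1 mod int p = 1" "d 1 * d' 1 mod int p = 1"
    using p1 by (simp_all add: Zp_ops c1 del: One_nat_def)
  then show "a \<in> Units Z" "d \<in> Units Z"
    using mem by (auto simp: Zp_Units_iff[OF prime])
qed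

lemma limit_matrix_classes_eq_Gamma0: "limit_matrix_classes p r = Gamma0_classes p r"
proof (intro equalityI subsetI)
  fix M assume "M \<in> limit_matrix_classes p r"
  then obtain t where t: "t \<in> Zp_triples p" "M = PGL2_class Z (triple_matrix t)"
    by (auto simp: limit_matrix_classes_eq matrix_class_def)
  obtain c s l where "t = (c, s, l)" by (metis prod_cases3)
  then have "s \<in> carrier Z" and m: "m21 (triple_matrix t) = K \<otimes>\<^bsub>Z\<^esub> s"
    using t by (simp_all add: Zp_triples_iff)
  then have "enat r \<le> padic_val p (m21 (triple_matrix t))"
    using K_closed unfolding m by (subst le_padic_val_iff[OF p_pos]) (simp_all add: Zp_mult Zp_of_int_at)
  then show "M \<in> Gamma0_classes p r"
    using t triple_matrix_in_GL2 unfolding Gamma0_classes_def by blast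
next
  fix M assume "M \<in> Gamma0_classes p r"
  then obtain A where A: "A \<in> carrier (GL2 Z)" "enat r \<le> padic_val p (m21 A)" "M = PGL2_class Z A"
    unfolding Gamma0_classes_def by blast
  obtain a b c d where A_eq: "A = Mat2 a b c d" by (cases A)
  have AG: "Mat2 a b c d \<in> carrier (GL2 Z)" using A(1) A_eq by simp
  note mem = Zp.GL2_closed[OF AG]
  have cr: "c r = 0"
    using A(2) mem by (simp add: A_eq le_padic_val_iff[OF p_pos])
  then obtain c0 where c0: "c0 \<in> carrier Z" "c = K \<otimes>\<^bsub>Z\<^esub> c0"
    using Zp_power_divides_iff[OF p_pos, of c r] mem unfolding factor_def by blast
  have U: "a \<in> Units Z" "d \<in> Units Z"
    using Gamma0_diagonal_Units[OF AG cr] by auto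
  define v where "v = inv\<^bsub>Z\<^esub> d"
  have v: "v \<in> Units Z" "v \<in> carrier Z" "v \<otimes>\<^bsub>Z\<^esub> d = \<one>\<^bsub>Z\<^esub>"
    using U by (simp_all add: v_def)
  have T: "(v \<otimes>\<^bsub>Z\<^esub> b, v \<otimes>\<^bsub>Z\<^esub> c0, v \<otimes>\<^bsub>Z\<^esub> a) \<in> Zp_triples p"
    using U v mem c0 by (simp add: Zp_triples_iff)
  have "M = PGL2_class Z (Mat2 (v \<otimes>\<^bsub>Z\<^esub> a) (v \<otimes>\<^bsub>Z\<^esub> b) (v \<otimes>\<^bsub>Z\<^esub> c) (v \<otimes>\<^bsub>Z\<^esub> d))"
    using Zp.PGL2_class_scalar[OF v(1) AG] by (simp add: A(3) A_eq)
  also have "\<dots> = matrix_class (v \<otimes>\<^bsub>Z\<^esub> b, v \<otimes>\<^bsub>Z\<^esub> c0, v \<otimes>\<^bsub>Z\<^esub> a)"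
    using v(2) c0 K_closed by (simp add: matrix_class_def v(3) Zp.m_lcomm)
  finally show "M \<in> limit_matrix_classes p r"
    using T by (simp add: limit_matrix_classes_eq)
qed

section \<open>Coherent families of triples\<close>

lemma triple_at_mem:
  assumes t: "t \<in> Zp_triples p" and q: "q \<ge> 1"
  shows "triple_at q t \<in> triples p q"
proof -
  interpret prime_power p r q using prime r q by unfold_locales
  obtain c s l where t_eq: "t = (c, s, l)" by (metis prod_cases3)
  have mem: "c \<in> carrier Z" "s \<in> carrier Z" "l \<in> carrier Z" "\<not> int p dvd l 1"
    using t by (auto simp: t_eq Zp_triples_iff Zp_Units_iff[OF prime])
  have "\<not> int p dvd l q"
    using Zp_coprime[OF prime mem(3,4), of q] unfolding coprime_m_iff .
  then show ?thesis
    using mem by (simp add: t_eq triples_iff Zp_carrier_iff)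
qed

lemma reduce_triple_at:
  assumes "t \<in> Zp_triples p" "n \<le> q"
  shows "reduce_triple p n (triple_at q t) = triple_at n t"
proof -
  obtain c s l where t: "t = (c, s, l)" by (metis prod_cases3)
  show ?thesis
    using assms by (simp add: t Zp_triples_iff Zp_mod_le Zp.Units_closed)
qed

lemma triple_at_inj:
  assumes "t \<in> Zp_triples p" "t' \<in> Zp_triples p" "\<And>q. q \<ge> 1 \<Longrightarrow> triple_at q t = triple_at q t'"
  shows "t = t'"
proof -
  obtain c s l where t: "t = (c, s, l)" by (metis prod_cases3)
  obtain c' s' l' where t': "t' = (c', s', l')" by (metis prod_cases3)
  have mem: "c \<in> carrier Z" "s \<in> carrier Z" "l \<in> carrier Z" "c' \<in> carrier Z" "s' \<in> carrier Z"
    "l' \<in> carrier Z"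
    using assms by (auto simp: t t' Zp_triples_iff Zp.Units_closed)
  have "c q = c' q \<and> s q = s' q \<and> l q = l' q" for q
    using assms(3)[of q] mem by (cases "q = 0") (auto simp: t t' Zp_at_0)
  then show ?thesis by (auto simp: t t')
qed

lemma ex_Zp_triple:
  assumes T: "\<And>q. q \<ge> 1 \<Longrightarrow> T q \<in> triples p q"
    and red: "\<And>q. q \<ge> 2 \<Longrightarrow> reduce_triple p (q - 1) (T q) = T (q - 1)"
  obtains t where "t \<in> Zp_triples p" "\<And>q. q \<ge> 1 \<Longrightarrow> triple_at q t = T q"
proof -
  \<comment> \<open>The tower starts at \<open>q = 1\<close>, whereas a p-adic integer also has an
    entry at level 0; it must be 0, the only residue modulo 1.\<close>
  define c s l where "c q = (if q = 0 then 0 else fst (T q))"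
    and "s q = (if q = 0 then 0 else fst (snd (T q)))"
    and "l q = (if q = 0 then 0 else snd (snd (T q)))" for q
  have T_eq: "T q = (c q, s q, l q)" if "q \<ge> 1" for q
    using that by (simp add: c_def s_def l_def)
  have 0: "c 0 = 0" "s 0 = 0" "l 0 = 0"
    by (simp_all add: c_def s_def l_def)
  have bd: "0 \<le> c q \<and> c q < int p ^ q \<and> 0 \<le> s q \<and> s q < int p ^ q \<and> 0 \<le> l q \<and> l q < int p ^ q
    \<and> \<not> int p dvd l q" if q: "q \<ge> 1" for q
  proof -
    interpret prime_power p r q using prime r q by unfold_locales
    show ?thesis using T[OF q] unfolding T_eq[OF q] triples_iff by blast
  qed
  have rd: "c (Suc q) mod int p ^ q = c q \<and> s (Suc q) mod int p ^ q = s q \<and> l (Suc q) mod int p ^ q = l q" for q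
  proof (cases "q = 0")
    case False
    then show ?thesis
      using red[of "Suc q"] by (simp add: T_eq)
  qed (simp add: 0)
  have bd': "0 \<le> c q \<and> c q < int p ^ q \<and> 0 \<le> s q \<and> s q < int p ^ q \<and> 0 \<le> l q \<and> l q < int p ^ q" for q
    using bd[of q] 0 by (cases "q = 0") auto
  have "(c, s, l) \<in> Zp_triples p"
    using bd' rd bd[of 1] by (simp add: Zp_triples_iff Zp_Units_iff[OF prime] Zp_carrier_iff)
  then show ?thesis
    by (rule that) (simp add: T_eq)
qed

end

section \<open>The inverse limit\<close>

locale character_tower = padic +
  fixes \<chi> :: "nat \<Rightarrow> (nat \<Rightarrow> int) set \<Rightarrow> complex"
  assumes faithful: "\<And>q. q \<ge> 1 \<Longrightarrow> faithful_character p r q (\<chi> q)"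
begin

lemma character_matrix: "q \<ge> 1 \<Longrightarrow> character_matrix p r q (\<chi> q)"
  using prime r faithful by unfold_locales

abbreviation "M q \<equiv> proj_mon_aut p r q (\<chi> q)"
abbreviation "class q \<equiv> triple_class p r q (\<chi> q)"

lemmas transition_class = transition_class[of p r \<chi>, OF character_matrix]
lemmas transition_hom = transition_hom[of p r \<chi>, OF character_matrix]

definition limit_class :: "padic_triple \<Rightarrow> nat \<Rightarrow> quad set" where
  "limit_class t = (\<lambda>q\<in>{1..}. class q (triple_at q t))"

lemma carrier_inverse_limit: "carrier (inverse_limit M (transition p r \<chi>)) =
    {x \<in> \<Pi>\<^sub>E q\<in>{1..}. carrier (M q). \<forall>q\<ge>2. transition p r \<chi> q (x q) = x (q - 1)}"
  by (simp add: inverse_limit_def)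

lemma limit_class_mem:
  assumes "t \<in> Zp_triples p"
  shows "limit_class t \<in> carrier (inverse_limit M (transition p r \<chi>))"
proof -
  have "class q (triple_at q t) \<in> carrier (M q)" if "q \<ge> 1" for q
    using character_matrix.carrier_proj_mon_aut[OF character_matrix[OF that]] triple_at_mem[OF assms that]
    by simp
  moreover have "transition p r \<chi> q (class q (triple_at q t)) = class (q - 1) (triple_at (q - 1) t)"
    if "q \<ge> 2" for q
    using that triple_at_mem[OF assms, of q] by (simp add: transition_class reduce_triple_at assms)
  ultimately show ?thesis
    unfolding carrier_inverse_limit limit_class_def by (auto simp: restrict_def)
qed

lemma limit_class_bij:
  "bij_betw limit_class (Zp_triples p) (carrier (inverse_limit M (transition p r \<chi>)))"
proof (rule bij_betwI')
  fix t t' assume t: "t \<in> Zp_triples p" "t' \<in> Zp_triples p"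
  show "limit_class t = limit_class t' \<longleftrightarrow> t = t'"
  proof
    assume eq: "limit_class t = limit_class t'"
    show "t = t'"
    proof (rule triple_at_inj[OF t])
      fix q :: nat assume q: "q \<ge> 1"
      have "class q (triple_at q t) = class q (triple_at q t')"
        using fun_cong[OF eq, of q] q by (simp add: limit_class_def)
      then show "triple_at q t = triple_at q t'"
        using t q by (intro character_matrix.triple_class_inj[OF character_matrix[OF q]] triple_at_mem)
    qed
  qed simp
next
  fix t assume "t \<in> Zp_triples p"
  then show "limit_class t \<in> carrier (inverse_limit M (transition p r \<chi>))"
    by (rule limit_class_mem)
next
  fix x assume "x \<in> carrier (inverse_limit M (transition p r \<chi>))"
  then have x: "x \<in> (\<Pi>\<^sub>E q\<in>{1..}. carrier (M q))"
    and tr: "\<And>q. q \<ge> 2 \<Longrightarrow> transition p r \<chi> q (x q) = x (q - 1)"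
    unfolding carrier_inverse_limit by auto
  have "\<exists>t. t \<in> triples p q \<and> x q = class q t" if "q \<ge> 1" for q
    using PiE_mem[OF x, of q] that character_matrix.carrier_proj_mon_aut[OF character_matrix[OF that]]
    by auto
  then obtain T where T: "T q \<in> triples p q" "x q = class q (T q)" if "q \<ge> 1" for q
    by metis
  \<comment> \<open>Compatibility is given for classes; injectivity of the class map at level
    \<open>q - 1\<close> transfers it to the triples.\<close>
  have red: "reduce_triple p (q - 1) (T q) = T (q - 1)" if q: "q \<ge> 2" for q
  proof -
    interpret A: prime_power p r q using prime r q by unfold_locales auto
    interpret B: character_matrix p r "q - 1" "\<chi> (q - 1)" using q by (intro character_matrix) simp
    have "B.class (reduce_triple p (q - 1) (T q)) = B.class (T (q - 1))"
      using tr[OF q] T[of q] T(2)[of "q - 1"] q by (simp add: transition_class)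
    then show ?thesis
      using q T by (intro B.triple_class_inj A.reduce_triple_mem) auto
  qed
  obtain t where t: "t \<in> Zp_triples p" "\<And>q. q \<ge> 1 \<Longrightarrow> triple_at q t = T q"
    using ex_Zp_triple[of T, OF T(1) red] by blast
  have "x = limit_class t"
    unfolding limit_class_def using x T t
    by (intro extensionalityI[of x "{1..}"]) (auto simp: PiE_iff)
  then show "\<exists>t\<in>Zp_triples p. x = limit_class t"
    using t by blast
qed

lemma limit_class_mult:
  assumes t: "t \<in> Zp_triples p" "t' \<in> Zp_triples p" "t'' \<in> Zp_triples p"
    and prod: "Zp_triple_prod p (int p ^ r) t t' t''"
  shows "limit_class t \<otimes>\<^bsub>inverse_limit M (transition p r \<chi>)\<^esub> limit_class t' = limit_class t''"
proof -
  have "class q (triple_at q t) \<otimes>\<^bsub>M q\<^esub> class q (triple_at q t') = class q (triple_at q t'')" if q: "q \<ge> 1" for q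
    using prod by (intro character_matrix.class_mult[OF character_matrix[OF q]] triple_at_mem t q)
      (simp add: Zp_triple_prod_def)
  then show ?thesis
    by (simp add: inverse_limit_def limit_class_def) (rule restrict_ext, simp)
qed

lemma inverse_limit_iso:
  "inverse_limit M (transition p r \<chi>) \<cong> (PGL2 (Zp p))\<lparr>carrier := limit_matrix_classes p r\<rparr>"
proof (rule is_isoI_common_parametrization[OF limit_class_bij])
  show "bij_betw matrix_class (Zp_triples p)
    (carrier ((PGL2 (Zp p))\<lparr>carrier := limit_matrix_classes p r\<rparr>))"
    using matrix_class_bij by simp
next
  fix t t' assume t: "t \<in> Zp_triples p" "t' \<in> Zp_triples p"
  obtain t'' where t'': "t'' \<in> Zp_triples p" "Zp_triple_prod p (int p ^ r) t t' t''"
    using Zp_triple_prod_closed[OF t] .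
  then show "\<exists>t''\<in>Zp_triples p.
      limit_class t \<otimes>\<^bsub>inverse_limit M (transition p r \<chi>)\<^esub> limit_class t' = limit_class t'' \<and>
      matrix_class t \<otimes>\<^bsub>(PGL2 (Zp p))\<lparr>carrier := limit_matrix_classes p r\<rparr>\<^esub> matrix_class t' = matrix_class t''"
    using t by (auto simp: limit_class_mult matrix_class_mult)
qed

end

theorem corollary3p3:
  fixes p r :: nat and \<chi> :: "nat \<Rightarrow> (nat \<Rightarrow> int) set \<Rightarrow> complex"
  assumes "Factorial_Ring.prime p" and "odd p" and "r \<ge> 1"
    and "\<And>q. q \<ge> 1 \<Longrightarrow> faithful_character p r q (\<chi> q)"
  shows
    "(\<forall>q\<ge>2. \<forall>t \<in> triples p q.
        reduce_triple p (q - 1) t \<in> triples p (q - 1) \<and>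
        (\<forall>b \<in> carrier (Rq p q). col_map p r q t b mod int p ^ (q - 1) =
           col_map p r (q - 1) (reduce_triple p (q - 1) t) (b mod int p ^ (q - 1))) \<and>
        (\<forall>a \<in> carrier (Rq p q). row_map p r q t a mod int p ^ (q - 1) =
           row_map p r (q - 1) (reduce_triple p (q - 1) t) (a mod int p ^ (q - 1))) \<and>
        transition p r \<chi> q (triple_class p r q (\<chi> q) t) =
          triple_class p r (q - 1) (\<chi> (q - 1)) (reduce_triple p (q - 1) t)) \<and>
     (\<forall>q\<ge>2. group_hom (proj_mon_aut p r q (\<chi> q)) (proj_mon_aut p r (q - 1) (\<chi> (q - 1)))
        (transition p r \<chi> q)) \<and>
     subgroup (limit_matrix_classes p r) (PGL2 (Zp p)) \<and>
     inverse_limit (\<lambda>q. proj_mon_aut p r q (\<chi> q)) (transition p r \<chi>)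
       \<cong> (PGL2 (Zp p))\<lparr>carrier := limit_matrix_classes p r\<rparr> \<and>
     limit_matrix_classes p r = Gamma0_classes p r"
proof -
  interpret character_tower p r \<chi>
    using assms by unfold_locales
  have "reduce_triple p (q - 1) t \<in> triples p (q - 1) \<and>
        (\<forall>b \<in> carrier (Rq p q). col_map p r q t b mod int p ^ (q - 1) =
           col_map p r (q - 1) (reduce_triple p (q - 1) t) (b mod int p ^ (q - 1))) \<and>
        (\<forall>a \<in> carrier (Rq p q). row_map p r q t a mod int p ^ (q - 1) =
           row_map p r (q - 1) (reduce_triple p (q - 1) t) (a mod int p ^ (q - 1)))"
    if "q \<ge> 2" "t \<in> triples p q" for q t
  proof -
    interpret prime_power p r q using prime r that by unfold_locales auto
    have q: "1 \<le> q - 1" "q - 1 \<le> q" using that by auto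
    show ?thesis
      using reduce_triple_mem[OF q that(2)] by (cases t) (simp add: moebius_mod[OF q] del: One_nat_def)
  qed
  then show ?thesis
    using transition_class transition_hom limit_matrix_classes_subgroup inverse_limit_iso
      limit_matrix_classes_eq_Gamma0
    by blast
qed

end
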